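(* Let $n\ge 1$, let $\alpha>0$ and $s:=2n-2+\alpha\le 2n$, let $a>0$, and let $X\subset\mathbb{C}^n$ belong to $\mathcal{A}_{2n}(s,a)$. Let $p$ be a holomorphic polynomial on $\mathbb{C}^n$ of degree $k$. Then for any Euclidean ball $B\subset\mathbb{C}^n$ and any $\mathcal{H}_s$-measurable subset $\omega\subset X\cap B$ one has $$\sup_B|p|\le\left(\frac{c_1\,\mathcal{H}_{2n}(B)}{\{\mathcal{H}_s(\omega)\}^{2n/s}}\right)^{c_2k}\sup_\omega|p|,$$ where the constant $c_1$ depends only on $a,n,k,\alpha$ and the constant $c_2>0$ depends only on $\alpha$ (in particular they do not depend on $X$, $B$, $\omega$ or the particular polynomial $p$ of degree $k$).
   Context: $\mathcal{H}_s$ denotes the $s$-dimensional Hausdorff measure; $\mathbb{C}^n$ is identified with $\mathbb{R}^{2n}$ with its Euclidean metric. Ahlfors regular sets: for $K\subset\mathbb{R}^m$ and $x\in K$, $B_r(x;K)$ denotes the intersection with $K$ of the open Euclidean ball of radius $r$ centered at $x$. $\mathcal{A}_m(s,a)$ is the class of sets $K\subset\mathbb{R}^m$ such that $\mathcal{H}_s(B_r(x;K))\le a r^s$ for every $x\in K$ and every $0<r\le\operatorname{diam}(K)$. A holomorphic polynomial on $\mathbb{C}^n$ is a polynomial in $z_1,\dots,z_n$ with complex coefficients. *)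

theory Defs
  imports "HOL-Analysis.Analysis" "HOL-Library.Poly_Mapping"
begin

section \<open>Hausdorff measure and Ahlfors regular sets in a metric space\<close>

context Metric_space
begin

text \<open>Extended diameter: infinite for unbounded sets, \<open>0\<close> for the empty set.\<close>

definition ediam :: "'a set \<Rightarrow> ennreal" where
  "ediam U = (SUP x\<in>U. SUP y\<in>U. ennreal (d x y))"

definition delta_cover :: "real \<Rightarrow> 'a set \<Rightarrow> (nat \<Rightarrow> 'a set) \<Rightarrow> bool" where
  "delta_cover \<delta> A U \<longleftrightarrow>
     (\<forall>i. U i \<subseteq> M \<and> ediam (U i) \<le> ennreal \<delta>) \<and> A \<subseteq> (\<Union>i. U i)"

text \<open>
  The \<open>s\<close>-dimensional Hausdorff outer measure, for \<open>s > 0\<close> (for \<open>s = 0\<close> the convention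
  \<open>0 powr 0 = 0\<close> would be wrong). It is not multiplied by a dimensional constant; in
  particular, in a Euclidean space the measure of top dimension is a fixed multiple of
  Lebesgue measure. Countable covers subsume finite ones, since the sets may be empty.
\<close>

definition hausdorff_pre :: "real \<Rightarrow> real \<Rightarrow> 'a set \<Rightarrow> ennreal" where
  "hausdorff_pre s \<delta> A =
     (INF U\<in>{U. delta_cover \<delta> A U}. suminf (\<lambda>i. ennreal (enn2real (ediam (U i)) powr s)))"

definition hausdorff :: "real \<Rightarrow> 'a set \<Rightarrow> ennreal" where
  "hausdorff s A = (SUP \<delta>\<in>{0<..}. hausdorff_pre s \<delta> A)"

text \<open>Measurability in the sense of Caratheodory.\<close>

definition hausdorff_measurable :: "real \<Rightarrow> 'a set set" where
  "hausdorff_measurable s = lambda_system M (Pow M) (hausdorff s)"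

text \<open>Only the upper bound is required; for unbounded \<open>K\<close> all radii are admitted.\<close>

definition ahlfors :: "real \<Rightarrow> real \<Rightarrow> 'a set set" where
  "ahlfors s a = {K. K \<subseteq> M \<and>
     (\<forall>x\<in>K. \<forall>r>0. ennreal r \<le> ediam K \<longrightarrow>
        hausdorff s (K \<inter> mball x r) \<le> ennreal (a * r powr s))}"

end


section \<open>The space \<open>\<complex>\<^sup>n\<close>\<close>

text \<open>
  The dimension has to be a term, not a type, because one constant is uniform in it.
  Points are functions on the naturals that are \<^const>\<open>undefined\<close> outside \<open>{..<n}\<close>. The
  distance is that of \<open>\<real>\<^sup>2\<^sup>n\<close>, because the metric of \<^typ>\<open>complex\<close> is that of the plane.
\<close>

definition cspace :: "nat \<Rightarrow> (nat \<Rightarrow> complex) set" where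
  "cspace n = {..<n} \<rightarrow>\<^sub>E UNIV"

definition cdist :: "nat \<Rightarrow> (nat \<Rightarrow> complex) \<Rightarrow> (nat \<Rightarrow> complex) \<Rightarrow> real" where
  "cdist n x y = L2_set (\<lambda>i. dist (x i) (y i)) {..<n}"

lemma Metric_space_cspace: "Metric_space (cspace n) (cdist n)"
proof
  fix x y z :: "nat \<Rightarrow> complex"
  show "0 \<le> cdist n x y"
    by (simp add: cdist_def)
  show "cdist n x y = cdist n y x"
    by (simp add: cdist_def dist_commute)
  show "cdist n x y = 0 \<longleftrightarrow> x = y" if "x \<in> cspace n" "y \<in> cspace n"
    using that unfolding cdist_def cspace_def
    by (auto simp: L2_set_eq_0_iff intro: PiE_ext)
  show "cdist n x z \<le> cdist n x y + cdist n y z"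
  proof -
    have "cdist n x z \<le> L2_set (\<lambda>i. dist (x i) (y i) + dist (y i) (z i)) {..<n}"
      unfolding cdist_def by (intro L2_set_mono dist_triangle) auto
    also have "\<dots> \<le> cdist n x y + cdist n y z"
      unfolding cdist_def by (rule L2_set_triangle_ineq)
    finally show ?thesis .
  qed
qed

interpretation Cn: Metric_space "cspace n" "cdist n" for n
  by (rule Metric_space_cspace)

text \<open>Open and closed balls are both admitted.\<close>

definition euclidean_ball :: "nat \<Rightarrow> (nat \<Rightarrow> complex) set \<Rightarrow> bool" where
  "euclidean_ball n B \<longleftrightarrow>
     (\<exists>x\<in>cspace n. \<exists>r>0. B = Cn.mball n x r \<or> B = Cn.mcball n x r)"


section \<open>Holomorphic polynomials\<close>

text \<open>
  A polynomial is a finitely supported map from monomials to coefficients, and a monomial a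
  finitely supported map from indices of variables to exponents.
\<close>

type_synonym cpoly = "(nat \<Rightarrow>\<^sub>0 nat) \<Rightarrow>\<^sub>0 complex"

definition poly_in :: "nat \<Rightarrow> cpoly \<Rightarrow> bool" where
  "poly_in n p \<longleftrightarrow> (\<forall>m\<in>Poly_Mapping.keys p. Poly_Mapping.keys m \<subseteq> {..<n})"

definition poly_eval :: "cpoly \<Rightarrow> (nat \<Rightarrow> complex) \<Rightarrow> complex" where
  "poly_eval p z = (\<Sum>m\<in>Poly_Mapping.keys p.
     Poly_Mapping.lookup p m * (\<Prod>i\<in>Poly_Mapping.keys m. z i ^ Poly_Mapping.lookup m i))"

definition monom_degree :: "(nat \<Rightarrow>\<^sub>0 nat) \<Rightarrow> nat" where
  "monom_degree m = (\<Sum>i\<in>Poly_Mapping.keys m. Poly_Mapping.lookup m i)"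

text \<open>The total degree; the zero polynomial has degree \<open>0\<close>.\<close>

definition total_degree :: "cpoly \<Rightarrow> nat" where
  "total_degree p = Max (insert 0 (monom_degree ` Poly_Mapping.keys p))"

end

theory Submission
  imports Defs "HOL-Complex_Analysis.Cauchy_Integral_Formula"
    "HOL-Computational_Algebra.Fundamental_Theorem_Algebra"
begin

text \<open>
  Scale \<open>B\<close> to unit size and let \<open>\<bar>p y\<bar> = S\<close> at a point \<open>y\<close> of \<open>B\<close>. For \<open>\<epsilon> \<le> c r\<^sup>k S\<close> the sublevel set
  \<open>{\<bar>p\<bar> \<le> \<epsilon>}\<close> is covered by \<open>O(r\<^bsup>2-2n\<^esup>)\<close> polydiscs of radius \<open>3 r\<close>: near a point \<open>z\<close> of this set, \<open>p\<close> must
  reach a multiple of \<open>r\<^sup>k S\<close> within distance \<open>r\<close>, so along a line in nearly that direction and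
  passing close to \<open>z\<close> it has a zero at distance \<open>O(r)\<close> from \<open>z\<close>. Finitely many directions and,
  for each of them, a grid of \<open>O(r\<^bsup>2-2n\<^esup>)\<close> lines suffice, and a line on which \<open>p\<close> does not vanish
  identically carries at most \<open>k\<close> zeros. By Ahlfors regularity the part of \<open>X\<close> in the sublevel set
  has measure \<open>O(r\<^bsup>2-2n\<^esup> r\<^sup>s) = O(r\<^sup>\<alpha>)\<close>. With \<open>\<epsilon>\<close> the supremum of \<open>\<bar>p\<bar>\<close> over \<open>\<omega>\<close> and \<open>r\<close> chosen so that
  this is less than the measure of \<open>\<omega>\<close>, one gets \<open>c r\<^sup>k S < \<epsilon>\<close>, which is the claim with \<open>c\<^sub>2 = 1/\<alpha>\<close>.
\<close>

section \<open>Polynomials in one variable\<close>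

lemma norm_coeff_le_of_bounded_on_disc:
  fixes q :: "complex poly"
  assumes "\<And>w. cmod w \<le> 1 \<Longrightarrow> cmod (poly q w) \<le> M"
  shows "cmod (coeff q j) \<le> M"
proof -
  have higher_deriv_poly: "(deriv ^^ j) (poly p) = poly ((pderiv ^^ j) p)" for p :: "complex poly" and j
  proof (induction j)
    case (Suc j)
    have "deriv (poly r) = poly (pderiv r)" for r :: "complex poly"
      by (rule ext) (rule DERIV_imp_deriv[OF poly_DERIV])
    then show ?case by (simp add: Suc)
  qed simp
  have "cmod ((deriv ^^ j) (poly q) 0) \<le> fact j * M / 1 ^ j"
    by (rule Cauchy_inequality) (use assms in \<open>auto intro!: holomorphic_intros continuous_intros simp: dist_norm\<close>)
  moreover have "(deriv ^^ j) (poly q) 0 = fact j * coeff q j"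
    by (simp add: higher_deriv_poly poly_0_coeff_0 coeff_higher_pderiv pochhammer_fact)
  ultimately show ?thesis
    by (simp add: norm_mult mult_le_cancel_left)
qed

lemma poly_eq_sum_upto:
  fixes q :: "complex poly"
  assumes "Polynomial.degree q \<le> k"
  shows "poly q w = (\<Sum>j\<le>k. coeff q j * w ^ j)"
  unfolding poly_altdef using assms
  by (intro sum.mono_neutral_left) (auto simp: not_le coeff_eq_0)

lemma norm_poly_growth:
  fixes q :: "complex poly"
  assumes "Polynomial.degree q \<le> k" and M: "\<And>w. cmod w \<le> 1 \<Longrightarrow> cmod (poly q w) \<le> M"
    and "cmod w \<le> t" "1 \<le> t"
  shows "cmod (poly q w) \<le> (real k + 1) * t ^ k * M"
proof -
  have "0 \<le> M" using order_trans[OF norm_ge_zero M[of 0]] by simp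
  have "cmod (poly q w) \<le> (\<Sum>j\<le>k. cmod (coeff q j) * cmod w ^ j)"
    unfolding poly_eq_sum_upto[OF assms(1)]
    by (rule order_trans[OF norm_sum]) (simp add: norm_mult norm_power)
  also have "\<dots> \<le> (\<Sum>j\<le>k. M * t ^ k)"
  proof (rule sum_mono)
    fix j assume "j \<in> {..k}"
    have "cmod w ^ j \<le> t ^ j" using assms by (intro power_mono) auto
    also have "\<dots> \<le> t ^ k" using assms \<open>j \<in> {..k}\<close> by (intro power_increasing) auto
    finally show "cmod (coeff q j) * cmod w ^ j \<le> M * t ^ k"
      using norm_coeff_le_of_bounded_on_disc[OF M] \<open>0 \<le> M\<close> by (intro mult_mono) auto
  qed
  finally show ?thesis by (simp add: algebra_simps)
qed

lemma norm_poly_diff_le: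
  fixes q :: "complex poly"
  assumes "Polynomial.degree q \<le> k" and M: "\<And>w. cmod w \<le> 1 \<Longrightarrow> cmod (poly q w) \<le> M"
    and "cmod w \<le> 1"
  shows "cmod (poly q w - poly q 0) \<le> k * M * cmod w"
proof -
  have "0 \<le> M" using order_trans[OF norm_ge_zero M[of 0]] by simp
  have "poly q w - poly q 0 = (\<Sum>j\<in>{1..k}. coeff q j * w ^ j)"
  proof -
    have "{..k} = insert 0 {1..k}" by auto
    then show ?thesis unfolding poly_eq_sum_upto[OF assms(1)] by (simp add: poly_0_coeff_0 power_0_left)
  qed
  also have "cmod \<dots> \<le> (\<Sum>j\<in>{1..k}. cmod (coeff q j) * cmod w ^ j)"
    by (rule order_trans[OF norm_sum]) (simp add: norm_mult norm_power)
  also have "\<dots> \<le> (\<Sum>j\<in>{1..k}. M * cmod w)"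
  proof (rule sum_mono)
    fix j assume "j \<in> {1..k}"
    then have "cmod w ^ j \<le> cmod w ^ 1" using assms by (intro power_decreasing) auto
    then show "cmod (coeff q j) * cmod w ^ j \<le> M * cmod w"
      using norm_coeff_le_of_bounded_on_disc[OF M] \<open>0 \<le> M\<close> by (intro mult_mono) auto
  qed
  finally show ?thesis by simp
qed

lemma poly_root_near:
  fixes q :: "complex poly"
  assumes "Polynomial.degree q \<le> k" and "2 ^ k * cmod (poly q x) < cmod (poly q (x + h))"
  obtains w where "poly q w = 0" "cmod (w - x) \<le> cmod h"
proof -
  have "\<exists>w. poly q w = 0 \<and> cmod (w - x) \<le> cmod h"
  proof (rule ccontr)
    assume H: "\<not> ?thesis"
    have *: "\<lbrakk>Polynomial.degree q = d; \<forall>w. poly q w = 0 \<longrightarrow> cmod h < cmod (w - x)\<rbrakk> \<Longrightarrow>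
      cmod (poly q (x + h)) \<le> 2 ^ d * cmod (poly q x)" for d q
    proof (induction d arbitrary: q)
      case 0
      then obtain a where "q = [:a:]" by (auto elim: degree_eq_zeroE)
      then show ?case by simp
    next
      case (Suc d)
      have "\<not> constant (poly q)" using Suc.prems by (simp add: constant_degree)
      then obtain w where w: "poly q w = 0" using fundamental_theorem_of_algebra by blast
      then obtain r where q: "q = [:- w, 1:] * r" by (auto simp: poly_eq_0_iff_dvd)
      have "r \<noteq> 0" using q Suc.prems by auto
      then have "Polynomial.degree r = d" using Suc.prems(1) q by (simp add: degree_mult_eq del: mult_pCons_left)
      moreover have "\<forall>w. poly r w = 0 \<longrightarrow> cmod h < cmod (w - x)" using Suc.prems(2) q by auto
      ultimately have IH: "cmod (poly r (x + h)) \<le> 2 ^ d * cmod (poly r x)" by (rule Suc.IH)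
      have "cmod (x + h - w) \<le> cmod (x - w) + cmod h"
        using norm_triangle_ineq[of "x - w" h] by (simp add: algebra_simps)
      also have "\<dots> \<le> 2 * cmod (x - w)" using Suc.prems(2) w by (simp add: norm_minus_commute less_imp_le)
      finally have prod: "cmod (x + h - w) * cmod (poly r (x + h)) \<le> (2 * cmod (x - w)) * (2 ^ d * cmod (poly r x))"
        using IH by (intro mult_mono) auto
      have val: "poly q y = (y - w) * poly r y" for y by (simp add: q algebra_simps)
      show ?case unfolding val norm_mult using prod by (simp add: mult_ac)
    qed
    have "cmod (poly q (x + h)) \<le> 2 ^ Polynomial.degree q * cmod (poly q x)" using H by (intro *) auto
    also have "\<dots> \<le> 2 ^ k * cmod (poly q x)" using assms by (intro mult_right_mono power_increasing) auto
    finally show False using assms by simp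
  qed
  then show ?thesis using that by blast
qed

section \<open>Restrictions to complex lines\<close>

text \<open>
  All estimates see a polynomial only through its restrictions to complex lines; unlike
  \<^typ>\<open>cpoly\<close>, this property is immediately stable under affine changes of variable.
\<close>

definition line_poly :: "nat \<Rightarrow> ((nat \<Rightarrow> complex) \<Rightarrow> complex) \<Rightarrow> bool" where
  "line_poly k f \<longleftrightarrow>
     (\<forall>x v. \<exists>q. Polynomial.degree q \<le> k \<and> (\<forall>w. f (\<lambda>i. x i + w * v i) = poly q w))"

definition polydisc :: "nat \<Rightarrow> (nat \<Rightarrow> complex) \<Rightarrow> real \<Rightarrow> (nat \<Rightarrow> complex) set" where
  "polydisc n x r = {y. \<forall>i<n. cmod (y i - x i) \<le> r}"

lemma polydiscI: "(\<And>i. i < n \<Longrightarrow> cmod (y i - x i) \<le> r) \<Longrightarrow> y \<in> polydisc n x r"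
  and polydiscD: "y \<in> polydisc n x r \<Longrightarrow> i < n \<Longrightarrow> cmod (y i - x i) \<le> r"
  by (auto simp: polydisc_def)

lemma line_polyE:
  assumes "line_poly k f"
  obtains q where "Polynomial.degree q \<le> k" "\<And>w. f (\<lambda>i. x i + w * v i) = poly q w"
  using assms unfolding line_poly_def by meson

lemma line_poly_growth:
  assumes "line_poly k f" and M: "\<And>y. y \<in> polydisc n z r \<Longrightarrow> cmod (f y) \<le> M"
    and "1 \<le> t" and y: "y \<in> polydisc n z (t * r)"
  shows "cmod (f y) \<le> (real k + 1) * t ^ k * M"
proof -
  define v where "v = (\<lambda>i. (y i - z i) / t)"
  obtain q where q: "Polynomial.degree q \<le> k" "\<And>w. f (\<lambda>i. z i + w * v i) = poly q w"
    using line_polyE[OF assms(1)] by metis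
  have "cmod (poly q w) \<le> M" if "cmod w \<le> 1" for w
  proof -
    have "cmod (w * v i) \<le> r" if "i < n" for i
    proof -
      have "cmod (v i) \<le> r"
        using y \<open>1 \<le> t\<close> that by (simp add: v_def polydisc_def norm_divide pos_divide_le_eq mult.commute)
      then show ?thesis using \<open>cmod w \<le> 1\<close> mult_mono[of "cmod w" 1 "cmod (v i)" r] by (simp add: norm_mult)
    qed
    then show ?thesis unfolding q(2)[symmetric] by (intro M) (auto simp: polydisc_def)
  qed
  then have "cmod (poly q t) \<le> (real k + 1) * t ^ k * M"
    using \<open>1 \<le> t\<close> by (intro norm_poly_growth q) auto
  moreover have "(\<lambda>i. z i + t * v i) = y" using \<open>1 \<le> t\<close> by (auto simp: v_def)
  ultimately show ?thesis using q(2)[of t] by simp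
qed

lemma line_poly_diff_le:
  assumes "line_poly k f" and M: "\<And>y. y \<in> polydisc n z r \<Longrightarrow> cmod (f y) \<le> M"
    and x: "x \<in> polydisc n z r" and y: "y \<in> polydisc n x (\<theta> * r)" and \<theta>: "0 < \<theta>" "\<theta> \<le> 1"
  shows "cmod (f y - f x) \<le> real k * (real k + 1) * 2 ^ k * M * \<theta>"
proof -
  define v where "v = (\<lambda>i. (y i - x i) / \<theta>)"
  obtain q where q: "Polynomial.degree q \<le> k" "\<And>w. f (\<lambda>i. x i + w * v i) = poly q w"
    using line_polyE[OF assms(1)] by metis
  have "cmod (poly q w) \<le> (real k + 1) * 2 ^ k * M" if "cmod w \<le> 1" for w
  proof -
    have "cmod (x i + w * v i - z i) \<le> 2 * r" if "i < n" for i
    proof -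
      have "cmod (v i) \<le> r"
        using y \<theta> that by (simp add: v_def polydisc_def norm_divide pos_divide_le_eq mult.commute)
      then have "cmod (w * v i) \<le> r"
        using \<open>cmod w \<le> 1\<close> mult_mono[of "cmod w" 1 "cmod (v i)" r] by (simp add: norm_mult)
      moreover have "cmod (x i - z i) \<le> r" using x that by (simp add: polydisc_def)
      ultimately show ?thesis
        using norm_triangle_ineq[of "x i - z i" "w * v i"] by (simp add: algebra_simps)
    qed
    then show ?thesis unfolding q(2)[symmetric]
      using line_poly_growth[OF assms(1) M, of n z r 2] by (simp add: polydisc_def algebra_simps)
  qed
  then have "cmod (poly q \<theta> - poly q 0) \<le> real k * ((real k + 1) * 2 ^ k * M) * cmod \<theta>"
    using \<theta> by (intro norm_poly_diff_le q) auto
  moreover have "(\<lambda>i. x i + \<theta> * v i) = y" using \<theta> by (auto simp: v_def)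
  ultimately show ?thesis using q(2)[of \<theta>] q(2)[of 0] \<theta> by (simp add: algebra_simps)
qed

section \<open>Covering sublevel sets\<close>

lemma complex_disc_net:
  assumes "0 < h" "0 \<le> R"
  obtains F :: "complex set" where "finite F" "real (card F) \<le> (2 * R / h + 2)\<^sup>2"
    "\<And>z. cmod z \<le> R \<Longrightarrow> \<exists>w\<in>F. cmod (z - w) \<le> h"
proof
  define K where "K = \<lfloor>R / h + 1 / 2\<rfloor>"
  define F where "F = (\<lambda>(a, b). Complex (h * of_int a) (h * of_int b)) ` ({-K..K} \<times> {-K..K})"
  show "finite F" by (simp add: F_def)
  have K: "0 \<le> K" "of_int K \<le> R / h + 1 / 2" using assms by (auto simp: K_def)
  have "card F \<le> card ({-K..K} \<times> {-K..K})" unfolding F_def by (rule card_image_le) simp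
  also have "\<dots> = (nat (2 * K + 1))\<^sup>2" by (simp add: card_cartesian_product power2_eq_square)
  finally have "real (card F) \<le> (real (nat (2 * K + 1)))\<^sup>2" by (metis of_nat_le_iff of_nat_power)
  also have "\<dots> \<le> (2 * R / h + 2)\<^sup>2" using K by (intro power_mono) auto
  finally show "real (card F) \<le> (2 * R / h + 2)\<^sup>2" .
  have coord: "\<exists>a\<in>{-K..K}. \<bar>x - h * of_int a\<bar> \<le> h / 2" if "\<bar>x\<bar> \<le> R" for x
  proof
    have close: "\<bar>x / h - of_int (round (x / h))\<bar> \<le> 1 / 2"
      using of_int_round_abs_le[of "x / h"] by (simp add: abs_minus_commute)
    have "\<bar>x / h\<bar> \<le> R / h" using that assms by (simp add: divide_right_mono)
    then have "\<bar>of_int (round (x / h))\<bar> \<le> R / h + 1 / 2" using close by linarith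
    then have "of_int \<bar>round (x / h)\<bar> \<le> R / h + 1 / 2" by simp
    then have "\<bar>round (x / h)\<bar> \<le> K" unfolding K_def by (simp only: le_floor_iff)
    then show "round (x / h) \<in> {-K..K}" by auto
    have "x - h * of_int (round (x / h)) = h * (x / h - of_int (round (x / h)))"
      using assms by (simp add: right_diff_distrib)
    then have "\<bar>x - h * of_int (round (x / h))\<bar> = h * \<bar>x / h - of_int (round (x / h))\<bar>"
      using assms by (simp only: abs_mult abs_of_pos)
    then show "\<bar>x - h * of_int (round (x / h))\<bar> \<le> h / 2" using close assms by simp
  qed
  fix z assume "cmod z \<le> R"
  then obtain a b where ab: "a \<in> {-K..K}" "\<bar>Re z - h * of_int a\<bar> \<le> h / 2"
    "b \<in> {-K..K}" "\<bar>Im z - h * of_int b\<bar> \<le> h / 2"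
    using coord abs_Re_le_cmod abs_Im_le_cmod order_trans by meson
  have "cmod (z - Complex (h * of_int a) (h * of_int b)) \<le> h"
    using cmod_le[of "z - Complex (h * of_int a) (h * of_int b)"] ab by simp
  moreover have "Complex (h * of_int a) (h * of_int b) \<in> F" using ab by (force simp: F_def)
  ultimately show "\<exists>w\<in>F. cmod (z - w) \<le> h" by blast
qed

lemma polydisc_net:
  assumes "0 < h" "0 \<le> R"
  obtains G where "finite G" "real (card G) \<le> ((2 * R / h + 2)\<^sup>2) ^ n"
    "\<And>z. z \<in> polydisc n x R \<Longrightarrow> \<exists>g\<in>G. z \<in> polydisc n g h"
proof -
  obtain F :: "complex set" where F: "finite F" "real (card F) \<le> (2 * R / h + 2)\<^sup>2"
    "\<And>z. cmod z \<le> R \<Longrightarrow> \<exists>w\<in>F. cmod (z - w) \<le> h"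
    using complex_disc_net[OF assms] by blast
  define G where "G = (\<lambda>g i. x i + g i) ` (PiE {..<n} (\<lambda>_. F))"
  show ?thesis
  proof
    show "finite G" using F by (auto simp: G_def intro!: finite_PiE)
    have "card G \<le> card F ^ n"
      unfolding G_def by (rule order_trans[OF card_image_le]) (use F in \<open>auto simp: card_PiE intro!: finite_PiE\<close>)
    then have "real (card G) \<le> real (card F) ^ n" by (metis of_nat_le_iff of_nat_power)
    also have "\<dots> \<le> ((2 * R / h + 2)\<^sup>2) ^ n" using F by (intro power_mono) auto
    finally show "real (card G) \<le> ((2 * R / h + 2)\<^sup>2) ^ n" .
    fix z assume z: "z \<in> polydisc n x R"
    have "\<forall>i<n. \<exists>w. w \<in> F \<and> cmod (z i - x i - w) \<le> h" using F(3) polydiscD[OF z] by blast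
    then obtain g where g: "\<And>i. i < n \<Longrightarrow> g i \<in> F \<and> cmod (z i - x i - g i) \<le> h" by metis
    show "\<exists>g\<in>G. z \<in> polydisc n g h"
    proof
      show "(\<lambda>i. x i + restrict g {..<n} i) \<in> G" unfolding G_def using g by (intro imageI restrict_PiE_iff[THEN iffD2]) auto
      show "z \<in> polydisc n (\<lambda>i. x i + restrict g {..<n} i) h"
        using g by (auto simp: polydisc_def algebra_simps)
    qed
  qed
qed

lemma slice_net:
  assumes "0 < h" "0 \<le> R" "i < n"
  obtains G where "finite G" "real (card G) \<le> ((2 * R / h + 2)\<^sup>2) ^ (n - 1)" "\<And>g. g \<in> G \<Longrightarrow> g i = c"
    "\<And>z. z i = c \<Longrightarrow> (\<And>j. j < n \<Longrightarrow> cmod (z j) \<le> R) \<Longrightarrow> \<exists>g\<in>G. z \<in> polydisc n g h"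
proof -
  obtain F :: "complex set" where F: "finite F" "real (card F) \<le> (2 * R / h + 2)\<^sup>2"
    "\<And>z. cmod z \<le> R \<Longrightarrow> \<exists>w\<in>F. cmod (z - w) \<le> h"
    using complex_disc_net[OF assms(1,2)] by blast
  define G where "G = PiE {..<n} (\<lambda>j. if j = i then {c} else F)"
  show ?thesis
  proof
    show "finite G" using F by (auto simp: G_def intro!: finite_PiE)
    have "card G = (\<Prod>j\<in>{..<n} - {i}. card F)"
      unfolding G_def card_PiE[OF finite_lessThan]
      using \<open>i < n\<close> by (subst prod.remove[of _ i]) auto
    then have "card G = card F ^ (n - 1)" using \<open>i < n\<close> by simp
    then have "real (card G) = real (card F) ^ (n - 1)" by simp
    also have "\<dots> \<le> ((2 * R / h + 2)\<^sup>2) ^ (n - 1)" using F by (intro power_mono) auto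
    finally show "real (card G) \<le> ((2 * R / h + 2)\<^sup>2) ^ (n - 1)" .
    show "g i = c" if "g \<in> G" for g
      using PiE_mem[OF that[unfolded G_def], of i] \<open>i < n\<close> by simp
    fix z :: "nat \<Rightarrow> complex" assume z: "z i = c" "\<And>j. j < n \<Longrightarrow> cmod (z j) \<le> R"
    have "\<forall>j<n. \<exists>w. w \<in> (if j = i then {c} else F) \<and> cmod (z j - w) \<le> h"
      using F(3) z \<open>0 < h\<close> by auto
    then obtain g where g: "\<And>j. j < n \<Longrightarrow> g j \<in> (if j = i then {c} else F) \<and> cmod (z j - g j) \<le> h"
      by metis
    show "\<exists>g\<in>G. z \<in> polydisc n g h"
    proof
      show "restrict g {..<n} \<in> G" unfolding G_def using g by (intro restrict_PiE_iff[THEN iffD2]) auto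
      show "z \<in> polydisc n (restrict g {..<n}) h" using g by (auto simp: polydisc_def)
    qed
  qed
qed

text \<open>
  Near \<open>z\<close> the function is much larger at some \<open>y = z + \<mu> w\<close>, \<open>w i = 1\<close>, than at \<open>z\<close>.
  This persists on every line with base point \<open>g\<close> and direction \<open>v\<close> close to those of the line
  through \<open>z\<close> and \<open>y\<close>, and a polynomial of degree \<open>k\<close> growing this fast has a root nearby.
\<close>

lemma line_poly_root_near:
  fixes n k :: nat
  defines "\<delta> \<equiv> 1 / (8 * 2 ^ k)"
  defines "\<theta> \<equiv> \<delta> / (k * (real k + 1) * 2 ^ k + 1)"
  assumes f: "line_poly k f" and "1 \<le> n" "0 < r" "0 < M"
    and M: "\<And>y. y \<in> polydisc n z r \<Longrightarrow> cmod (f y) \<le> M"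
    and y: "y \<in> polydisc n z r" "M / 2 \<le> cmod (f y)"
    and small: "cmod (f z) \<le> \<delta> * M"
  obtains i w where "i < n" "w i = 1" "\<And>j. j < n \<Longrightarrow> cmod (w j) \<le> 1"
    "\<And>v g. \<lbrakk>v \<in> polydisc n w (\<theta> / 2); g \<in> polydisc n (\<lambda>j. z j - z i * v j) (\<theta> * r / 2)\<rbrakk> \<Longrightarrow>
       \<exists>l. f (\<lambda>j. g j + l * v j) = 0 \<and> cmod (l - z i) \<le> r \<and> (\<exists>l'. f (\<lambda>j. g j + l' * v j) \<noteq> 0)"
proof -
  define C where "C = k * (real k + 1) * 2 ^ k"
  have C: "0 \<le> C" by (simp add: C_def)
  have \<delta>: "0 < \<delta>" "\<delta> \<le> 1 / 8" by (auto simp: \<delta>_def divide_simps)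
  have \<theta>: "0 < \<theta>" "\<theta> \<le> 1" "C * \<theta> \<le> \<delta>"
    using C \<delta> by (auto simp: \<theta>_def divide_simps mult_left_le simp flip: C_def intro: order_trans[of _ 1])
  have zz: "z \<in> polydisc n z r" using \<open>0 < r\<close> by (simp add: polydisc_def)
  have close: "cmod (f b - f a) \<le> \<delta> * M" if "a \<in> polydisc n z r" "b \<in> polydisc n a (\<theta> * r)" for a b
  proof -
    have "cmod (f b - f a) \<le> C * M * \<theta>"
      unfolding C_def using line_poly_diff_le[OF f M] that \<theta> by blast
    also have "\<dots> \<le> \<delta> * M" using \<theta>(3) \<open>0 < M\<close> mult_right_mono[of "C * \<theta>" \<delta> M] by (simp add: mult_ac)
    finally show ?thesis .
  qed
  have "Max ((\<lambda>j. cmod (y j - z j)) ` {..<n}) \<in> (\<lambda>j. cmod (y j - z j)) ` {..<n}"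
    using \<open>1 \<le> n\<close> by (intro Max_in) (auto simp: lessThan_empty_iff)
  then obtain i where i: "i < n" "cmod (y i - z i) = Max ((\<lambda>j. cmod (y j - z j)) ` {..<n})" by auto
  define \<mu> where "\<mu> = y i - z i"
  have max: "cmod (y j - z j) \<le> cmod \<mu>" if "j < n" for j using that i by (auto simp: \<mu>_def)
  have \<mu>_le: "cmod \<mu> \<le> r" using polydiscD[OF y(1) i(1)] by (simp add: \<mu>_def)
  have "\<mu> \<noteq> 0"
  proof
    assume "\<mu> = 0"
    then have "y \<in> polydisc n z (\<theta> * r)" using max \<theta> \<open>0 < r\<close> by (auto simp: polydisc_def)
    from close[OF zz this] have "cmod (f y) \<le> \<delta> * M + \<delta> * M"
      using small norm_triangle_ineq2[of "f y" "f z"] by linarith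
    also have "\<dots> \<le> M / 8 + M / 8" using \<delta>(2) \<open>0 < M\<close> by (simp add: mult.commute)
    finally show False using y \<open>0 < M\<close> by simp
  qed
  define w where "w = (\<lambda>j. (y j - z j) / \<mu>)"
  have w: "w i = 1" "\<And>j. j < n \<Longrightarrow> cmod (w j) \<le> 1"
    using max \<open>\<mu> \<noteq> 0\<close> by (auto simp: w_def norm_divide \<mu>_def divide_le_eq_1)
  show ?thesis
  proof (rule that[of i w, OF i(1) w])
    fix v g assume v: "v \<in> polydisc n w (\<theta> / 2)"
      and g: "g \<in> polydisc n (\<lambda>j. z j - z i * v j) (\<theta> * r / 2)"
    obtain q where q: "Polynomial.degree q \<le> k" "\<And>l. f (\<lambda>j. g j + l * v j) = poly q l"
      using line_polyE[OF f] by metis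
    have "cmod (poly q (z i) - f z) \<le> \<delta> * M"
      unfolding q(2)[symmetric]
    proof (rule close[OF zz], rule polydiscI)
      fix j assume "j < n"
      from polydiscD[OF g this] show "cmod (g j + z i * v j - z j) \<le> \<theta> * r"
        using \<theta>(1) \<open>0 < r\<close> by (simp add: algebra_simps) (smt (verit) mult_pos_pos)
    qed
    then have q0: "cmod (poly q (z i)) \<le> 2 * \<delta> * M"
      using small norm_triangle_ineq2[of "poly q (z i)" "f z"] by linarith
    have "cmod (poly q (z i + \<mu>) - f y) \<le> \<delta> * M"
      unfolding q(2)[symmetric]
    proof (rule close[OF y(1)], rule polydiscI)
      fix j assume "j < n"
      have "cmod (g j - (z j - z i * v j)) \<le> \<theta> * r / 2" using g \<open>j < n\<close> by (rule polydiscD)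
      moreover have "cmod (\<mu> * (v j - w j)) \<le> r * (\<theta> / 2)"
        unfolding norm_mult using \<mu>_le polydiscD[OF v \<open>j < n\<close>] \<open>0 < r\<close> by (intro mult_mono) auto
      ultimately have "cmod ((g j - (z j - z i * v j)) + \<mu> * (v j - w j)) \<le> \<theta> * r / 2 + r * (\<theta> / 2)"
        by (rule norm_triangle_mono)
      moreover have "g j + (z i + \<mu>) * v j - y j = (g j - (z j - z i * v j)) + \<mu> * (v j - w j)"
        using \<open>\<mu> \<noteq> 0\<close> by (simp add: w_def field_simps)
      ultimately have "cmod (g j + (z i + \<mu>) * v j - y j) \<le> \<theta> * r / 2 + r * (\<theta> / 2)"
        by (simp only:)
      then show "cmod (g j + (z i + \<mu>) * v j - y j) \<le> \<theta> * r" by (simp add: mult.commute[of r])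
    qed
    then have q1: "M / 2 - \<delta> * M \<le> cmod (poly q (z i + \<mu>))"
      using y(2) norm_triangle_ineq2[of "f y" "poly q (z i + \<mu>)"] by (simp add: norm_minus_commute)
    have "2 ^ k * cmod (poly q (z i)) \<le> 2 ^ k * (2 * \<delta> * M)" using q0 by (intro mult_left_mono) auto
    also have "\<dots> = M / 4" by (simp add: \<delta>_def)
    also have "\<dots> < M / 2 - M / 8" using \<open>0 < M\<close> by simp
    also have "\<dots> \<le> M / 2 - \<delta> * M" using \<delta>(2) \<open>0 < M\<close> by (simp add: mult.commute)
    also note q1
    finally have big: "2 ^ k * cmod (poly q (z i)) < cmod (poly q (z i + \<mu>))" .
    then obtain l where l: "poly q l = 0" "cmod (l - z i) \<le> cmod \<mu>" using poly_root_near[OF q(1)] by metis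
    have "poly q (z i + \<mu>) \<noteq> 0" using le_less_trans[OF _ big, of 0] by auto
    then show "\<exists>l. f (\<lambda>j. g j + l * v j) = 0 \<and> cmod (l - z i) \<le> r \<and> (\<exists>l'. f (\<lambda>j. g j + l' * v j) \<noteq> 0)"
      using l \<mu>_le q(2) by (intro exI[of _ l]) auto
  qed
qed

lemma card_zeros_on_line:
  assumes "line_poly k f" and ne: "f (\<lambda>j. g j + l' * v j) \<noteq> 0"
  shows "finite {l. f (\<lambda>j. g j + l * v j) = 0}" "card {l. f (\<lambda>j. g j + l * v j) = 0} \<le> k"
proof -
  obtain q where q: "Polynomial.degree q \<le> k" "\<And>l. f (\<lambda>j. g j + l * v j) = poly q l"
    using line_polyE[OF assms(1)] by metis
  have "q \<noteq> 0" using ne q(2) by auto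
  then show "finite {l. f (\<lambda>j. g j + l * v j) = 0}" "card {l. f (\<lambda>j. g j + l * v j) = 0} \<le> k"
    using q card_poly_roots_bound[of q] by (auto simp: poly_roots_finite)
qed

lemma sublevel_covering:
  fixes n k :: nat
  assumes "1 \<le> n"
  obtains c C :: real where "0 < c" "0 < C"
    "\<And>f r y0. \<lbrakk>line_poly k f; \<And>z. bdd_above ((\<lambda>y. cmod (f y)) ` polydisc n z r);
        y0 \<in> polydisc n (\<lambda>_. 0) 1; f y0 \<noteq> 0; 0 < r; r \<le> 1\<rbrakk> \<Longrightarrow>
      \<exists>T. finite T \<and> real (card T) \<le> C / r ^ (2 * (n - 1)) \<and>
        (\<forall>z\<in>polydisc n (\<lambda>_. 0) 1. cmod (f z) \<le> c * r ^ k * cmod (f y0) \<longrightarrow>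
           (\<exists>t\<in>T. z \<in> polydisc n t (3 * r)))"
proof -
  define \<delta> :: real where "\<delta> = 1 / (8 * 2 ^ k)"
  define \<theta> where "\<theta> = \<delta> / (k * (real k + 1) * 2 ^ k + 1)"
  have "1 \<le> 8 * (2::real) ^ k" using one_le_power[of "2::real" k] by linarith
  then have \<delta>: "0 < \<delta>" "\<delta> \<le> 1" by (auto simp: \<delta>_def pos_divide_le_eq)
  have \<theta>: "0 < \<theta>" "\<theta> \<le> 1"
    using \<delta> by (auto simp: \<theta>_def pos_divide_le_eq add_nonneg_pos intro: order_trans[of _ 1])
  have "\<forall>i. \<exists>V. i < n \<longrightarrow> finite V \<and> (\<forall>w. w i = 1 \<longrightarrow> (\<forall>j<n. cmod (w j) \<le> 1) \<longrightarrow>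
          (\<exists>v\<in>V. v i = 1 \<and> w \<in> polydisc n v (\<theta> / 2)))"
  proof
    fix i show "\<exists>V. i < n \<longrightarrow> finite V \<and> (\<forall>w. w i = 1 \<longrightarrow> (\<forall>j<n. cmod (w j) \<le> 1) \<longrightarrow>
          (\<exists>v\<in>V. v i = 1 \<and> w \<in> polydisc n v (\<theta> / 2)))"
      using slice_net[of "\<theta> / 2" 1 i n 1] \<theta> by (metis half_gt_zero zero_le_one)
  qed
  then obtain V where V: "\<And>i. i < n \<Longrightarrow> finite (V i)"
    "\<And>i w. i < n \<Longrightarrow> w i = 1 \<Longrightarrow> (\<And>j. j < n \<Longrightarrow> cmod (w j) \<le> 1) \<Longrightarrow>
       \<exists>v\<in>V i. v i = 1 \<and> w \<in> polydisc n v (\<theta> / 2)"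
    by metis
  define c where "c = \<delta> / ((real k + 1) * 2 ^ k)"
  define N where "N = real (\<Sum>i<n. card (V i))"
  define C where "C = N * k * (14 / \<theta>) ^ (2 * (n - 1)) + 1"
  have "0 < c" using \<delta> by (auto simp: c_def)
  have "0 < C" using \<theta> by (auto simp: C_def N_def intro!: add_nonneg_pos mult_nonneg_nonneg sum_nonneg)
  have "\<exists>T. finite T \<and> real (card T) \<le> C / r ^ (2 * (n - 1)) \<and>
        (\<forall>z\<in>polydisc n (\<lambda>_. 0) 1. cmod (f z) \<le> c * r ^ k * cmod (f y0) \<longrightarrow>
           (\<exists>t\<in>T. z \<in> polydisc n t (3 * r)))"
    if f: "line_poly k f" and bdd: "\<And>z. bdd_above ((\<lambda>y. cmod (f y)) ` polydisc n z r)"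
      and y0: "y0 \<in> polydisc n (\<lambda>_. 0) 1" "f y0 \<noteq> 0" and r: "0 < r" "r \<le> 1" for f r y0
  proof -
    have "\<forall>i. \<exists>G. i < n \<longrightarrow> finite G \<and> real (card G) \<le> (14 / \<theta>) ^ (2 * (n - 1)) / r ^ (2 * (n - 1)) \<and>
       (\<forall>z. z i = 0 \<longrightarrow> (\<forall>j<n. cmod (z j) \<le> 3) \<longrightarrow> (\<exists>g\<in>G. z \<in> polydisc n g (\<theta> * r / 2)))"
    proof (intro allI)
      fix i
      have h: "0 < \<theta> * r / 2" "(0::real) \<le> 3" using \<theta> r by auto
      show "\<exists>G. i < n \<longrightarrow> finite G \<and> real (card G) \<le> (14 / \<theta>) ^ (2 * (n - 1)) / r ^ (2 * (n - 1)) \<and>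
        (\<forall>z. z i = 0 \<longrightarrow> (\<forall>j<n. cmod (z j) \<le> 3) \<longrightarrow> (\<exists>g\<in>G. z \<in> polydisc n g (\<theta> * r / 2)))"
      proof (cases "i < n")
        case True
        obtain G where G: "finite G" "real (card G) \<le> ((2 * 3 / (\<theta> * r / 2) + 2)\<^sup>2) ^ (n - 1)"
          "\<And>z. z i = 0 \<Longrightarrow> (\<And>j. j < n \<Longrightarrow> cmod (z j) \<le> 3) \<Longrightarrow> \<exists>g\<in>G. z \<in> polydisc n g (\<theta> * r / 2)"
          using slice_net[OF h True, of 0] by metis
        have "\<theta> * r \<le> 1" using \<theta> r by (simp add: mult_le_one)
        then have "2 * 3 / (\<theta> * r / 2) + 2 \<le> 14 / \<theta> / r" using \<theta> r by (simp add: field_simps)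
        then have "((2 * 3 / (\<theta> * r / 2) + 2)\<^sup>2) ^ (n - 1) \<le> ((14 / \<theta> / r)\<^sup>2) ^ (n - 1)"
          using \<theta> r by (intro power_mono) auto
        also have "\<dots> = (14 / \<theta>) ^ (2 * (n - 1)) / r ^ (2 * (n - 1))"
          by (simp only: power_mult[symmetric] power_divide)
        finally have "real (card G) \<le> (14 / \<theta>) ^ (2 * (n - 1)) / r ^ (2 * (n - 1))"
          using G(2) by (rule order_trans[rotated])
        then show ?thesis using G(1,3) by (intro exI[of _ G]) auto
      qed auto
    qed
    then obtain G where G: "\<And>i. i < n \<Longrightarrow> finite (G i)"
       "\<And>i. i < n \<Longrightarrow> real (card (G i)) \<le> (14 / \<theta>) ^ (2 * (n - 1)) / r ^ (2 * (n - 1))"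
       "\<And>i z. i < n \<Longrightarrow> z i = 0 \<Longrightarrow> (\<And>j. j < n \<Longrightarrow> cmod (z j) \<le> 3) \<Longrightarrow> \<exists>g\<in>G i. z \<in> polydisc n g (\<theta> * r / 2)"
      by metis
    define D where "D = (14 / \<theta>) ^ (2 * (n - 1)) / r ^ (2 * (n - 1))"
    define Z where "Z = (\<lambda>v g. if \<exists>l'. f (\<lambda>j. g j + l' * v j) \<noteq> 0
        then (\<lambda>l j. g j + l * v j) ` {l. f (\<lambda>j. g j + l * v j) = 0} else {})"
    have "finite (Z v g) \<and> card (Z v g) \<le> k" for v g
    proof (cases "\<exists>l'. f (\<lambda>j. g j + l' * v j) \<noteq> 0")
      case True
      then obtain l' where "f (\<lambda>j. g j + l' * v j) \<noteq> 0" by blast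
      note zeros = card_zeros_on_line[OF f this]
      have "Z v g = (\<lambda>l j. g j + l * v j) ` {l. f (\<lambda>j. g j + l * v j) = 0}"
        unfolding Z_def using True by (rule if_P)
      then show ?thesis using zeros(1) order_trans[OF card_image_le[OF zeros(1)] zeros(2)] by simp
    next
      case False
      then have "Z v g = {}" unfolding Z_def by (rule if_not_P)
      then show ?thesis by simp
    qed
    then have Z: "finite (Z v g)" "card (Z v g) \<le> k" for v g by blast+
    define T where "T = (\<Union>i<n. \<Union>v\<in>V i. \<Union>g\<in>G i. Z v g)"
    have "finite T" unfolding T_def using V(1) G(1) Z by blast
    moreover have "real (card T) \<le> C / r ^ (2 * (n - 1))"
    proof -
      have "card T \<le> (\<Sum>i<n. \<Sum>v\<in>V i. \<Sum>g\<in>G i. card (Z v g))"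
        unfolding T_def
        by (intro order_trans[OF card_UN_le] sum_mono) (auto simp: V(1) G(1))
      also have "\<dots> \<le> (\<Sum>i<n. \<Sum>v\<in>V i. \<Sum>g\<in>G i. k)" by (intro sum_mono Z)
      finally have "real (card T) \<le> real (\<Sum>i<n. card (V i) * (card (G i) * k))"
        by (simp only: sum_constant of_nat_id of_nat_le_iff)
      also have "\<dots> \<le> (\<Sum>i<n. real (card (V i)) * (D * k))"
        unfolding of_nat_sum of_nat_mult using G(2)
        by (intro sum_mono mult_left_mono mult_right_mono) (auto simp: D_def)
      also have "\<dots> = N * (D * k)" by (simp add: N_def sum_distrib_right)
      also have "\<dots> \<le> C / r ^ (2 * (n - 1))" using r by (simp add: C_def D_def field_simps)
      finally show ?thesis .
    qed
    moreover have "\<exists>t\<in>T. z \<in> polydisc n t (3 * r)"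
      if z: "z \<in> polydisc n (\<lambda>_. 0) 1" and small: "cmod (f z) \<le> c * r ^ k * cmod (f y0)" for z
    proof -
      define M where "M = (SUP y\<in>polydisc n z r. cmod (f y))"
      have M: "cmod (f y) \<le> M" if "y \<in> polydisc n z r" for y
        unfolding M_def using that bdd by (rule cSUP_upper)
      have zc: "cmod (z j) \<le> 1" if "j < n" for j using polydiscD[OF z that] by simp
      have "y0 \<in> polydisc n z (2 / r * r)"
      proof (rule polydiscI)
        fix j assume "j < n"
        then show "cmod (y0 j - z j) \<le> 2 / r * r"
          using r norm_triangle_ineq4[of "y0 j" "z j"] zc[of j] polydiscD[OF y0(1), of j] by simp
      qed
      then have grow: "cmod (f y0) \<le> (real k + 1) * (2 / r) ^ k * M"
        using line_poly_growth[OF f M, of n z r "2 / r" y0] r by (simp add: divide_simps)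
      have "0 < cmod (f y0)" using y0 by simp
      with grow have "0 < (real k + 1) * (2 / r) ^ k * M" by linarith
      moreover have "0 < (real k + 1) * (2 / r) ^ k" using r by simp
      ultimately have "0 < M" by (rule zero_less_mult_pos)
      have "c * r ^ k * cmod (f y0) \<le> c * r ^ k * ((real k + 1) * (2 / r) ^ k * M)"
        using grow r \<open>0 < c\<close> by (intro mult_left_mono) auto
      also have "\<dots> = \<delta> * M" using r by (simp add: c_def power_divide)
      finally have sm: "cmod (f z) \<le> \<delta> * M" using small by linarith
      have "z \<in> polydisc n z r" using r by (simp add: polydisc_def)
      then have "\<exists>y\<in>polydisc n z r. M / 2 < cmod (f y)"
        using less_cSUP_iff[OF _ bdd, of z "M / 2"] \<open>0 < M\<close> unfolding M_def[symmetric] by auto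
      then obtain y where y: "y \<in> polydisc n z r" "M / 2 \<le> cmod (f y)" by (auto intro: less_imp_le)
      note near = line_poly_root_near[OF f \<open>1 \<le> n\<close> r(1) \<open>0 < M\<close> M y, folded \<delta>_def, folded \<theta>_def, OF _ sm]
      show ?thesis
      proof (rule near)
        fix i w
        assume i: "i < n" "w i = 1" and w: "\<And>j. j < n \<Longrightarrow> cmod (w j) \<le> 1"
        assume root: "\<And>v g. \<lbrakk>v \<in> polydisc n w (\<theta> / 2); g \<in> polydisc n (\<lambda>j. z j - z i * v j) (\<theta> * r / 2)\<rbrakk> \<Longrightarrow>
          \<exists>l. f (\<lambda>j. g j + l * v j) = 0 \<and> cmod (l - z i) \<le> r \<and> (\<exists>l'. f (\<lambda>j. g j + l' * v j) \<noteq> 0)"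
        obtain v where v: "v \<in> V i" "v i = 1" "w \<in> polydisc n v (\<theta> / 2)" using V(2)[of i w, OF i w] by blast
        have v2: "cmod (v j) \<le> 2" if "j < n" for j
          using norm_triangle_ineq2[of "v j" "w j"] polydiscD[OF v(3) that] w[OF that] \<theta>(2)
          by (simp add: norm_minus_commute)
        have "cmod (z j - z i * v j) \<le> 3" if "j < n" for j
        proof -
          have "cmod (z i * v j) \<le> 1 * 2" unfolding norm_mult
            using zc[OF i(1)] v2[OF that] by (intro mult_mono) auto
          then show ?thesis using norm_triangle_ineq4[of "z j" "z i * v j"] zc[OF that] by simp
        qed
        then obtain g where g: "g \<in> G i" "(\<lambda>j. z j - z i * v j) \<in> polydisc n g (\<theta> * r / 2)"
          using G(3)[of i, OF i(1), of "\<lambda>j. z j - z i * v j"] v(2) by auto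
        obtain l l' where l: "f (\<lambda>j. g j + l * v j) = 0" "cmod (l - z i) \<le> r" "f (\<lambda>j. g j + l' * v j) \<noteq> 0"
          using root[of v g] v(3) g(2) by (auto simp: polydisc_def norm_minus_commute)
        have "(\<lambda>j. g j + l * v j) \<in> Z v g" using l by (auto simp: Z_def)
        then have "(\<lambda>j. g j + l * v j) \<in> T" unfolding T_def using i v g by blast
        moreover have "z \<in> polydisc n (\<lambda>j. g j + l * v j) (3 * r)"
        proof (rule polydiscI)
          fix j assume "j < n"
          have "z j - (g j + l * v j) = (z j - z i * v j - g j) - (l - z i) * v j" by (simp add: algebra_simps)
          also have "cmod \<dots> \<le> \<theta> * r / 2 + r * 2"
          proof (rule norm_triangle_le_diff, rule add_mono)
            show "cmod (z j - z i * v j - g j) \<le> \<theta> * r / 2" using polydiscD[OF g(2) \<open>j < n\<close>] .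
            show "cmod ((l - z i) * v j) \<le> r * 2"
              unfolding norm_mult using l(2) v2[OF \<open>j < n\<close>] r by (intro mult_mono) auto
          qed
          also have "\<dots> \<le> 3 * r" using \<theta> r mult_right_mono[of \<theta> 1 r] by simp
          finally show "cmod (z j - (g j + l * v j)) \<le> 3 * r" .
        qed
        ultimately show ?thesis by blast
      qed
    qed
    ultimately show ?thesis by blast
  qed
  show ?thesis by (rule that[of c C]; fact)
qed

section \<open>Hausdorff measure\<close>

lemma subadditive_finite_cover:
  fixes \<mu> :: "'a set \<Rightarrow> ennreal"
  assumes mono: "\<And>A B. A \<subseteq> B \<Longrightarrow> \<mu> A \<le> \<mu> B" and Un: "\<And>A B. \<mu> (A \<union> B) \<le> \<mu> A + \<mu> B"
    and empty: "\<mu> {} = 0"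
    and "finite T" "A \<subseteq> (\<Union>t\<in>T. W t)" "\<And>t. t \<in> T \<Longrightarrow> \<mu> (A \<inter> W t) \<le> ennreal b"
    and "real (card T) \<le> N" "0 \<le> b"
  shows "\<mu> A \<le> ennreal (N * b)"
proof -
  have "\<mu> (\<Union>t\<in>T. A \<inter> W t) \<le> of_nat (card T) * ennreal b"
    using assms(4,6)
  proof (induction T rule: finite_induct)
    case (insert t T)
    have "\<mu> (\<Union>t\<in>insert t T. A \<inter> W t) \<le> \<mu> (A \<inter> W t) + \<mu> (\<Union>t\<in>T. A \<inter> W t)" using Un by simp
    also have "\<dots> \<le> ennreal b + of_nat (card T) * ennreal b" using insert by (intro add_mono) auto
    finally show ?case using insert by (simp add: distrib_right)
  qed (simp add: empty)
  moreover have "of_nat (card T) * ennreal b = ennreal (card T * b)"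
    using \<open>0 \<le> b\<close> by (simp add: ennreal_mult ennreal_of_nat_eq_real_of_nat)
  moreover have "ennreal (card T * b) \<le> ennreal (N * b)" using assms by (intro ennreal_leI mult_right_mono)
  moreover have "A = (\<Union>t\<in>T. A \<inter> W t)" using assms(5) by blast
  ultimately show ?thesis by (metis order_trans)
qed

context Metric_space
begin

lemma ediam_le: "(\<And>x y. x \<in> U \<Longrightarrow> y \<in> U \<Longrightarrow> d x y \<le> D) \<Longrightarrow> ediam U \<le> ennreal D"
  unfolding ediam_def by (intro SUP_least ennreal_leI)

lemma dist_le_ediam: "x \<in> U \<Longrightarrow> y \<in> U \<Longrightarrow> ennreal (d x y) \<le> ediam U"
  unfolding ediam_def by (intro SUP_upper2[of x] SUP_upper2[of y] order_refl)

lemma hausdorff_pre_mono: "A \<subseteq> B \<Longrightarrow> hausdorff_pre s \<delta> A \<le> hausdorff_pre s \<delta> B"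
  unfolding hausdorff_pre_def delta_cover_def by (intro INF_superset_mono order_refl) blast

lemma hausdorff_mono: "A \<subseteq> B \<Longrightarrow> hausdorff s A \<le> hausdorff s B"
  unfolding hausdorff_def by (intro SUP_mono) (blast intro: hausdorff_pre_mono)

lemma hausdorff_pre_Un:
  "hausdorff_pre s \<delta> (A \<union> B) \<le> hausdorff_pre s \<delta> A + hausdorff_pre s \<delta> B"
proof -
  define m where "m = (\<lambda>U. suminf (\<lambda>i. ennreal (enn2real (ediam (U i)) powr s)))"
  have *: "hausdorff_pre s \<delta> (A \<union> B) \<le> m U + m V" if "delta_cover \<delta> A U" "delta_cover \<delta> B V" for U V
  proof -
    define W where "W = (\<lambda>i. if even i then U (i div 2) else V (i div 2))"
    have "(\<Union>i. U i) \<union> (\<Union>i. V i) \<subseteq> (\<Union>i. W i)"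
    proof -
      have "U i = W (2 * i)" "V i = W (2 * i + 1)" for i by (auto simp: W_def)
      then show ?thesis by blast
    qed
    moreover have "W i \<subseteq> M \<and> ediam (W i) \<le> ennreal \<delta>" for i
      using that by (auto simp: W_def delta_cover_def)
    ultimately have "delta_cover \<delta> (A \<union> B) W" using that unfolding delta_cover_def by blast
    then have "hausdorff_pre s \<delta> (A \<union> B) \<le> m W" unfolding hausdorff_pre_def m_def by (auto intro: INF_lower)
    also have "m W \<le> m U + m V"
      unfolding m_def
    proof (subst suminf_eq_SUP, rule SUP_least)
      fix N
      let ?w = "\<lambda>W i. ennreal (enn2real (ediam (W i)) powr s)"
      have "(\<Sum>i<N. ?w W i) \<le> (\<Sum>i<2*N. ?w W i)" by (intro sum_mono2) auto
      also have "\<dots> = (\<Sum>i<N. ?w U i) + (\<Sum>i<N. ?w V i)"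
        by (induction N) (auto simp: W_def ac_simps)
      also have "\<dots> \<le> suminf (?w U) + suminf (?w V)" by (intro add_mono sum_le_suminf) auto
      finally show "(\<Sum>i<N. ?w W i) \<le> suminf (?w U) + suminf (?w V)" .
    qed
    finally show ?thesis .
  qed
  show ?thesis
  proof (rule ennreal_le_epsilon)
    fix e :: real assume "0 < e" and fin: "hausdorff_pre s \<delta> A + hausdorff_pre s \<delta> B < top"
    have ex: "\<exists>U\<in>{U. delta_cover \<delta> A U}. m U < hausdorff_pre s \<delta> A + ennreal (e / 2)" if "hausdorff_pre s \<delta> A < top" for A
    proof -
      have "hausdorff_pre s \<delta> A + 0 < hausdorff_pre s \<delta> A + ennreal (e / 2)"
        using that \<open>0 < e\<close> by (subst ennreal_add_left_cancel_less) auto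
      then have "(INF U\<in>{U. delta_cover \<delta> A U}. m U) < hausdorff_pre s \<delta> A + ennreal (e / 2)"
        by (simp add: hausdorff_pre_def m_def)
      then show ?thesis unfolding INF_less_iff .
    qed
    have fin': "hausdorff_pre s \<delta> A < top" "hausdorff_pre s \<delta> B < top"
      using fin by (auto simp: less_top)
    obtain U where U: "delta_cover \<delta> A U" "m U < hausdorff_pre s \<delta> A + ennreal (e / 2)"
      using ex[OF fin'(1)] by blast
    obtain V where V: "delta_cover \<delta> B V" "m V < hausdorff_pre s \<delta> B + ennreal (e / 2)"
      using ex[OF fin'(2)] by blast
    have "hausdorff_pre s \<delta> (A \<union> B) \<le> m U + m V" using * U V by blast
    also have "\<dots> \<le> (hausdorff_pre s \<delta> A + ennreal (e / 2)) + (hausdorff_pre s \<delta> B + ennreal (e / 2))"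
      using U V by (intro add_mono) auto
    also have "\<dots> = hausdorff_pre s \<delta> A + hausdorff_pre s \<delta> B + (ennreal (e / 2) + ennreal (e / 2))"
      by (simp add: ac_simps)
    also have "ennreal (e / 2) + ennreal (e / 2) = ennreal e"
      using \<open>0 < e\<close> by (subst ennreal_plus[symmetric]) auto
    finally show "hausdorff_pre s \<delta> (A \<union> B) \<le> hausdorff_pre s \<delta> A + hausdorff_pre s \<delta> B + ennreal e" .
  qed
qed

lemma hausdorff_Un: "hausdorff s (A \<union> B) \<le> hausdorff s A + hausdorff s B"
  unfolding hausdorff_def
proof (rule SUP_least)
  fix \<delta> :: real assume "\<delta> \<in> {0<..}"
  then show "hausdorff_pre s \<delta> (A \<union> B)
      \<le> (SUP \<delta>\<in>{0<..}. hausdorff_pre s \<delta> A) + (SUP \<delta>\<in>{0<..}. hausdorff_pre s \<delta> B)"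
    by (intro order_trans[OF hausdorff_pre_Un] add_mono SUP_upper)
qed

lemma hausdorff_pre_single:
  assumes "A \<subseteq> M" "0 < s" "\<And>x y. x \<in> A \<Longrightarrow> y \<in> A \<Longrightarrow> d x y \<le> D" "0 \<le> D" "D \<le> \<delta>"
  shows "hausdorff_pre s \<delta> A \<le> ennreal (D powr s)"
proof -
  define U where "U = (\<lambda>i::nat. if i = 0 then A else {})"
  have e: "ediam {} = 0" by (simp add: ediam_def bot_ennreal)
  have A: "ediam A \<le> ennreal D" using assms(3) by (rule ediam_le)
  then have "delta_cover \<delta> A U"
    using assms unfolding delta_cover_def by (auto simp: U_def e intro: order_trans[OF _ ennreal_leI])
  then have "hausdorff_pre s \<delta> A \<le> suminf (\<lambda>i. ennreal (enn2real (ediam (U i)) powr s))"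
    unfolding hausdorff_pre_def by (auto intro: INF_lower)
  also have "\<dots> = (\<Sum>i\<in>{0}. ennreal (enn2real (ediam (U i)) powr s))"
    by (rule suminf_finite) (auto simp: U_def e)
  also have "\<dots> \<le> ennreal (D powr s)"
    using enn2real_mono[OF A] assms by (auto simp: U_def intro!: ennreal_leI powr_mono2)
  finally show ?thesis .
qed

lemma hausdorff_singleton:
  assumes "A \<subseteq> {x}" "x \<in> M" "0 < s"
  shows "hausdorff s A = 0"
proof -
  have "hausdorff_pre s \<delta> A \<le> 0" if "0 < \<delta>" for \<delta>
    using hausdorff_pre_single[of A s 0 \<delta>] assms that by (auto simp: subset_singleton_iff)
  then show ?thesis unfolding hausdorff_def by (simp add: SUP_eq_iff[of _ 0])
qed

lemma hausdorff_finite_cover: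
  assumes "0 < s" "finite T" "A \<subseteq> (\<Union>t\<in>T. W t)" "\<And>t. t \<in> T \<Longrightarrow> hausdorff s (A \<inter> W t) \<le> ennreal b"
    "real (card T) \<le> N" "0 \<le> b" "M \<noteq> {}"
  shows "hausdorff s A \<le> ennreal (N * b)"
proof (rule subadditive_finite_cover[of "hausdorff s", OF hausdorff_mono hausdorff_Un _ assms(2-6)])
  show "hausdorff s {} = 0" using hausdorff_singleton[of "{}"] assms by blast
qed

lemma hausdorff_pre_finite_cover:
  assumes "0 < s" "finite T" "A \<subseteq> (\<Union>t\<in>T. W t)" "A \<subseteq> M"
    "\<And>t x y. t \<in> T \<Longrightarrow> x \<in> M \<inter> W t \<Longrightarrow> y \<in> M \<inter> W t \<Longrightarrow> d x y \<le> D" "0 \<le> D" "D \<le> \<delta>"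
    "real (card T) \<le> N"
  shows "hausdorff_pre s \<delta> A \<le> ennreal (N * D powr s)"
proof (rule subadditive_finite_cover[of "hausdorff_pre s \<delta>", OF hausdorff_pre_mono hausdorff_pre_Un _ assms(2,3)])
  show "hausdorff_pre s \<delta> {} = 0" using hausdorff_pre_single[of "{}" s 0 \<delta>] assms by simp
  show "hausdorff_pre s \<delta> (A \<inter> W t) \<le> ennreal (D powr s)" if "t \<in> T" for t
  proof (rule hausdorff_pre_single)
    fix x y assume "x \<in> A \<inter> W t" "y \<in> A \<inter> W t"
    then show "d x y \<le> D" using assms(4,5) that by blast
  qed (use assms in auto)
qed (use assms in auto)

end

lemma cdist_polydisc:
  assumes "y \<in> polydisc n x r" shows "cdist n x y \<le> n * r"
proof -
  have "cdist n x y \<le> (\<Sum>i<n. \<bar>dist (x i) (y i)\<bar>)" unfolding cdist_def by (rule L2_set_le_sum_abs)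
  also have "\<dots> \<le> (\<Sum>i<n. r)"
    using assms by (intro sum_mono) (auto simp: polydisc_def dist_norm norm_minus_commute)
  finally show ?thesis by simp
qed

lemma cdist_same_polydisc:
  assumes "x \<in> polydisc n g r" "y \<in> polydisc n g r" shows "cdist n x y \<le> n * (2 * r)"
proof (rule cdist_polydisc, rule polydiscI)
  fix i assume "i < n"
  then show "cmod (y i - x i) \<le> 2 * r"
    using norm_triangle_ineq4[of "y i - g i" "x i - g i"] polydiscD[OF assms(1), of i] polydiscD[OF assms(2), of i]
    by simp
qed

lemma mem_polydisc_cdist: "cdist n x y \<le> r \<Longrightarrow> y \<in> polydisc n x r"
proof (rule polydiscI)
  fix i assume "cdist n x y \<le> r" "i < n"
  then show "cmod (y i - x i) \<le> r"
    using member_le_L2_set[of "{..<n}" i "\<lambda>i. dist (x i) (y i)"]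
    by (auto simp: cdist_def dist_norm norm_minus_commute)
qed

lemma cspace_nonempty: "cspace n \<noteq> {}"
  by (auto simp: cspace_def PiE_eq_empty_iff)

lemma hausdorff_ahlfors_polydisc:
  assumes X: "X \<in> Cn.ahlfors n s a" and "0 < s" "0 < a" "0 < \<rho>" "1 \<le> n"
  shows "Cn.hausdorff n s (X \<inter> polydisc n t \<rho>) \<le> ennreal (((16 * real n + 2)\<^sup>2) ^ n * (a * \<rho> powr s))"
proof (cases "\<exists>x. X \<inter> polydisc n t \<rho> \<subseteq> {x} \<and> x \<in> cspace n")
  case True
  then show ?thesis using Cn.hausdorff_singleton \<open>0 < s\<close> by (metis zero_le)
next
  case False
  have Xs: "X \<subseteq> cspace n" using X by (simp add: Cn.ahlfors_def)
  obtain x where x: "x \<in> X" "x \<in> polydisc n t \<rho>" using False cspace_nonempty by (metis Int_iff equals0I empty_subsetI ex_in_conv)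
  then obtain y where y: "y \<in> X" "y \<noteq> x" using False Xs by blast
  have "0 < cdist n x y" using x y Xs by (intro Cn.mdist_pos_less) auto
  with Cn.dist_le_ediam[OF x(1) y(1)] have pos: "0 < Cn.ediam n X"
    by (metis ennreal_less_zero_iff less_le_trans)
  define \<rho>' where "\<rho>' = (if Cn.ediam n X = top then \<rho> else min \<rho> (enn2real (Cn.ediam n X)))"
  have \<rho>': "0 < \<rho>'" "\<rho>' \<le> \<rho>"
    using pos \<open>0 < \<rho>\<close> by (auto simp: \<rho>'_def enn2real_positive_iff less_top)
  have \<rho>'d: "ennreal \<rho>' \<le> Cn.ediam n X"
  proof (cases "Cn.ediam n X = top")
    case False
    then have "ennreal \<rho>' \<le> ennreal (enn2real (Cn.ediam n X))" by (intro ennreal_leI) (simp add: \<rho>'_def)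
    then show ?thesis using False by (simp only: ennreal_enn2real less_top)
  qed auto
  have sub: "X \<inter> polydisc n t \<rho> \<subseteq> polydisc n x (2 * \<rho>')"
  proof
    fix z assume z: "z \<in> X \<inter> polydisc n t \<rho>"
    have 1: "z \<in> polydisc n x (2 * \<rho>)"
    proof (rule polydiscI)
      fix i assume "i < n"
      then show "cmod (z i - x i) \<le> 2 * \<rho>"
        using norm_triangle_ineq4[of "z i - t i" "x i - t i"] polydiscD[of z n t \<rho> i] polydiscD[OF x(2), of i] z
        by simp
    qed
    have 2: "z \<in> polydisc n x (enn2real (Cn.ediam n X))" if "Cn.ediam n X \<noteq> top"
    proof (rule mem_polydisc_cdist)
      have "enn2real (ennreal (cdist n x z)) \<le> enn2real (Cn.ediam n X)"
        using Cn.dist_le_ediam[OF x(1), of z] z that by (intro enn2real_mono) (auto simp: less_top)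
      then show "cdist n x z \<le> enn2real (Cn.ediam n X)" by simp
    qed
    show "z \<in> polydisc n x (2 * \<rho>')"
    proof (rule polydiscI)
      fix i assume i: "i < n"
      show "cmod (z i - x i) \<le> 2 * \<rho>'"
      proof (cases "Cn.ediam n X = top \<or> \<rho> \<le> enn2real (Cn.ediam n X)")
        case True
        then have "\<rho>' = \<rho>" by (auto simp: \<rho>'_def)
        then show ?thesis using polydiscD[OF 1 i] by simp
      next
        case False
        then have "\<rho>' = enn2real (Cn.ediam n X)" by (auto simp: \<rho>'_def)
        then show ?thesis using polydiscD[OF 2 i] False \<rho>' by linarith
      qed
    qed
  qed
  define h where "h = \<rho>' / (4 * n)"
  have h: "0 < h" using \<rho>' \<open>1 \<le> n\<close> by (simp add: h_def)
  obtain G where G: "finite G" "real (card G) \<le> ((2 * (2 * \<rho>') / h + 2)\<^sup>2) ^ n"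
    "\<And>z. z \<in> polydisc n x (2 * \<rho>') \<Longrightarrow> \<exists>g\<in>G. z \<in> polydisc n g h"
    using polydisc_net[OF h, of "2 * \<rho>'" n x] \<rho>' by auto
  have "2 * (2 * \<rho>') / h + 2 = 16 * real n + 2" using \<rho>' \<open>1 \<le> n\<close> by (simp add: h_def)
  then have card: "real (card G) \<le> ((16 * real n + 2)\<^sup>2) ^ n" using G(2) by simp
  show ?thesis
  proof (rule Cn.hausdorff_finite_cover[OF \<open>0 < s\<close> G(1) _ _ card _ cspace_nonempty, where W = "\<lambda>g. polydisc n g h"])
    show "X \<inter> polydisc n t \<rho> \<subseteq> (\<Union>g\<in>G. polydisc n g h)" using G(3) sub by blast
    show "0 \<le> a * \<rho> powr s" using assms by simp
    fix g assume "g \<in> G"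
    show "Cn.hausdorff n s (X \<inter> polydisc n t \<rho> \<inter> polydisc n g h) \<le> ennreal (a * \<rho> powr s)"
    proof (cases "X \<inter> polydisc n g h = {}")
      case True
      then have "X \<inter> polydisc n t \<rho> \<inter> polydisc n g h = {}" by blast
      then show ?thesis using Cn.hausdorff_singleton[of "{}" _ n s] cspace_nonempty[of n] \<open>0 < s\<close> by auto
    next
      case False
      then obtain y where y: "y \<in> X" "y \<in> polydisc n g h" by blast
      have "X \<inter> polydisc n t \<rho> \<inter> polydisc n g h \<subseteq> X \<inter> Cn.mball n y \<rho>'"
      proof
        fix z assume z: "z \<in> X \<inter> polydisc n t \<rho> \<inter> polydisc n g h"
        then have "cdist n y z \<le> n * (2 * h)" using y by (intro cdist_same_polydisc) auto
        also have "\<dots> < \<rho>'" using \<rho>' \<open>1 \<le> n\<close> by (simp add: h_def)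
        finally show "z \<in> X \<inter> Cn.mball n y \<rho>'" using z y Xs by (auto simp: Cn.in_mball)
      qed
      then have "Cn.hausdorff n s (X \<inter> polydisc n t \<rho> \<inter> polydisc n g h) \<le> Cn.hausdorff n s (X \<inter> Cn.mball n y \<rho>')"
        by (rule Cn.hausdorff_mono)
      also have "\<dots> \<le> ennreal (a * \<rho>' powr s)"
        using X y(1) \<rho>'(1) \<rho>'d by (auto simp: Cn.ahlfors_def)
      also have "\<dots> \<le> ennreal (a * \<rho> powr s)"
        using \<rho>' assms by (intro ennreal_leI mult_left_mono powr_mono2) auto
      finally show ?thesis .
    qed
  qed
qed

lemma powr_double_nat: "0 \<le> x \<Longrightarrow> 1 \<le> n \<Longrightarrow> x powr (2 * real n) = x ^ (2 * n)"
  using powr_realpow[of x "2 * n"] by (cases "x = 0") auto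

lemma hausdorff_full_dim_le:
  assumes "1 \<le> n" "B \<subseteq> cspace n" "B \<subseteq> polydisc n x R" "0 < R"
  shows "Cn.hausdorff n (2 * real n) B \<le> ennreal ((8 * real n * R) ^ (2 * n))"
  unfolding Cn.hausdorff_def
proof (rule SUP_least)
  fix \<delta> :: real assume "\<delta> \<in> {0<..}"
  define h where "h = min R (\<delta> / (2 * n))"
  have h: "0 < h" "h \<le> R" "n * (2 * h) \<le> \<delta>"
  proof -
    have "h \<le> \<delta> / (2 * n)" by (simp add: h_def)
    then show "n * (2 * h) \<le> \<delta>" using \<open>1 \<le> n\<close> by (simp add: field_simps)
  qed (use \<open>\<delta> \<in> {0<..}\<close> assms in \<open>auto simp: h_def\<close>)
  obtain G where G: "finite G" "real (card G) \<le> ((2 * R / h + 2)\<^sup>2) ^ n"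
    "\<And>z. z \<in> polydisc n x R \<Longrightarrow> \<exists>g\<in>G. z \<in> polydisc n g h"
    using polydisc_net[OF h(1), of R n x] \<open>0 < R\<close> by auto
  have "Cn.hausdorff_pre n (2 * real n) \<delta> B \<le> ennreal (((2 * R / h + 2)\<^sup>2) ^ n * (n * (2 * h)) powr (2 * real n))"
  proof (rule Cn.hausdorff_pre_finite_cover[OF _ G(1), where W = "\<lambda>g. polydisc n g h"])
    show "B \<subseteq> (\<Union>g\<in>G. polydisc n g h)" using G(3) assms by blast
  qed (use assms h G in \<open>auto intro: cdist_same_polydisc\<close>)
  also have "\<dots> \<le> ennreal ((8 * real n * R) ^ (2 * n))"
  proof (rule ennreal_leI)
    have "((2 * R / h + 2)\<^sup>2) ^ n * (n * (2 * h)) powr (2 * real n) = ((2 * R / h + 2) * (n * (2 * h))) ^ (2 * n)"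
      using powr_double_nat[of "n * (2 * h)" n] h \<open>1 \<le> n\<close>
      by (simp only: power_mult_distrib power_mult[symmetric]) auto
    also have "\<dots> \<le> (8 * real n * R) ^ (2 * n)"
    proof (rule power_mono)
      have "(2 * R / h + 2) * (n * (2 * h)) = 4 * real n * R + 4 * real n * h" using h by (simp add: field_simps)
      also have "\<dots> \<le> 4 * real n * R + 4 * real n * R" using h by (intro add_left_mono mult_left_mono) auto
      finally show "(2 * R / h + 2) * (n * (2 * h)) \<le> 8 * real n * R" by simp
    qed (use h \<open>0 < R\<close> in auto)
    finally show "((2 * R / h + 2)\<^sup>2) ^ n * (n * (2 * h)) powr (2 * real n) \<le> (8 * real n * R) ^ (2 * n)" .
  qed
  finally show "Cn.hausdorff_pre n (2 * real n) \<delta> B \<le> ennreal ((8 * real n * R) ^ (2 * n))" .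
qed

lemma emeasure_lborel_square:
  assumes "0 \<le> d"
  shows "emeasure lborel (cbox (c - Complex d d) (c + Complex d d)) = ennreal ((2 * d)\<^sup>2)"
proof -
  have "emeasure lborel (cbox (c - Complex d d) (c + Complex d d))
      = (\<Prod>b\<in>Basis. ((c + Complex d d) - (c - Complex d d)) \<bullet> b)"
    using assms by (intro emeasure_lborel_cbox) (auto simp: Basis_complex_def inner_complex_def)
  also have "(\<Prod>b\<in>Basis. ((c + Complex d d) - (c - Complex d d)) \<bullet> b) = (2 * d)\<^sup>2"
    by (simp add: Basis_complex_def inner_complex_def power2_eq_square)
  finally show ?thesis .
qed

text \<open>A set of diameter \<open>d\<close> lies in a cube of side \<open>2 d\<close>; compare with product Lebesgue measure.\<close>

lemma hausdorff_full_dim_ge: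
  assumes "1 \<le> n" "0 < R" "x \<in> cspace n" and B: "Cn.mball n x R \<subseteq> B"
  shows "ennreal ((R / (4 * n)) ^ (2 * n)) \<le> Cn.hausdorff n (2 * real n) B"
proof -
  interpret product_sigma_finite "\<lambda>_::nat. lborel :: complex measure" by standard
  define L where "L = PiM {..<n} (\<lambda>_. lborel :: complex measure)"
  define Q where "Q = (\<lambda>c d. PiE {..<n} (\<lambda>i. cbox (c i - Complex d d) (c i + Complex d d)))"
  have Q_sets: "Q c d \<in> sets L" for c d unfolding Q_def L_def by (intro sets_PiM_I_finite) auto
  have Q_vol: "emeasure L (Q c d) = ennreal ((2 * d) ^ (2 * n))" if "0 \<le> d" for c d
  proof -
    have "emeasure L (Q c d) = (\<Prod>i<n. emeasure lborel (cbox (c i - Complex d d) (c i + Complex d d)))"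
      unfolding Q_def L_def by (intro emeasure_PiM) auto
    also have "\<dots> = ennreal (((2 * d)\<^sup>2) ^ n)" using that by (simp only: emeasure_lborel_square) (simp add: ennreal_power)
    finally show ?thesis by (simp only: power_mult)
  qed
  define \<rho> where "\<rho> = R / (4 * n)"
  have "0 < \<rho>" using assms by (simp add: \<rho>_def)
  have "Q x \<rho> \<subseteq> B"
  proof
    fix z assume z: "z \<in> Q x \<rho>"
    have "z \<in> polydisc n x (2 * \<rho>)"
    proof (rule polydiscI)
      fix i assume "i < n"
      then have "z i \<in> cbox (x i - Complex \<rho> \<rho>) (x i + Complex \<rho> \<rho>)" using z by (auto simp: Q_def)
      then have "\<bar>Re (z i - x i)\<bar> \<le> \<rho>" "\<bar>Im (z i - x i)\<bar> \<le> \<rho>" by (auto simp: in_cbox_complex_iff)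
      then show "cmod (z i - x i) \<le> 2 * \<rho>" using cmod_le[of "z i - x i"] by linarith
    qed
    then have "cdist n x z \<le> n * (2 * \<rho>)" by (rule cdist_polydisc)
    also have "\<dots> < R" using assms by (simp add: \<rho>_def)
    finally have "cdist n x z < R" .
    moreover have "z \<in> cspace n" using z by (auto simp: Q_def cspace_def PiE_iff)
    ultimately have "z \<in> Cn.mball n x R" using \<open>x \<in> cspace n\<close> by (simp add: Cn.in_mball)
    then show "z \<in> B" using B by blast
  qed
  have lower: "ennreal (\<rho> ^ (2 * n)) \<le> suminf (\<lambda>i. ennreal (enn2real (Cn.ediam n (U i)) powr (2 * real n)))"
    if U: "Cn.delta_cover n 1 B U" for U
  proof -
    define D where "D = (\<lambda>i. enn2real (Cn.ediam n (U i)))"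
    define P where "P = (\<lambda>i. if U i = {} then {} else Q (SOME y. y \<in> U i) (D i))"
    have UP: "U i \<subseteq> P i" for i
    proof
      fix z assume z: "z \<in> U i"
      define y where "y = (SOME y. y \<in> U i)"
      have y: "y \<in> U i" unfolding y_def using z by (rule someI[of "\<lambda>y. y \<in> U i"])
      have "Cn.ediam n (U i) \<le> ennreal 1" using U by (auto simp: Cn.delta_cover_def)
      then have "Cn.ediam n (U i) < top" using ennreal_less_top order_le_less_trans by blast
      then have "enn2real (ennreal (cdist n y z)) \<le> D i"
        unfolding D_def using Cn.dist_le_ediam[OF y z] by (intro enn2real_mono)
      then have near: "z \<in> polydisc n y (D i)" by (intro mem_polydisc_cdist) simp
      have "z j \<in> cbox (y j - Complex (D i) (D i)) (y j + Complex (D i) (D i))" if "j < n" for j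
        using polydiscD[OF near that] abs_Re_le_cmod[of "z j - y j"] abs_Im_le_cmod[of "z j - y j"]
        by (auto simp: in_cbox_complex_iff)
      moreover have "z \<in> cspace n" using U z by (auto simp: Cn.delta_cover_def)
      ultimately have "z \<in> Q y (D i)" by (auto simp: Q_def cspace_def PiE_iff)
      then show "z \<in> P i" using z by (auto simp: P_def y_def)
    qed
    have "ennreal ((2 * \<rho>) ^ (2 * n)) = emeasure L (Q x \<rho>)" using Q_vol \<open>0 < \<rho>\<close> by simp
    also have "\<dots> \<le> emeasure L (\<Union>i. P i)"
    proof (rule emeasure_mono)
      show "Q x \<rho> \<subseteq> (\<Union>i. P i)" using \<open>Q x \<rho> \<subseteq> B\<close> U UP unfolding Cn.delta_cover_def by blast
    qed (auto simp: P_def Q_sets)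
    also have "\<dots> \<le> suminf (\<lambda>i. emeasure L (P i))"
      by (intro emeasure_subadditive_countably) (auto simp: P_def Q_sets)
    also have "\<dots> \<le> suminf (\<lambda>i. ennreal (2 ^ (2 * n)) * ennreal (D i powr (2 * real n)))"
    proof (rule suminf_le)
      fix i
      have "0 \<le> D i" by (simp add: D_def)
      then have "emeasure L (P i) \<le> ennreal ((2 * D i) ^ (2 * n))" by (simp add: P_def Q_vol)
      also have "\<dots> = ennreal (2 ^ (2 * n)) * ennreal (D i powr (2 * real n))"
        using \<open>0 \<le> D i\<close> \<open>1 \<le> n\<close> by (simp only: powr_double_nat power_mult_distrib) (simp add: ennreal_mult)
      finally show "emeasure L (P i) \<le> ennreal (2 ^ (2 * n)) * ennreal (D i powr (2 * real n))" .
    qed auto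
    also have "\<dots> = ennreal (2 ^ (2 * n)) * suminf (\<lambda>i. ennreal (D i powr (2 * real n)))"
      by (rule ennreal_suminf_cmult)
    finally have "ennreal (2 ^ (2 * n)) * ennreal (\<rho> ^ (2 * n))
        \<le> ennreal (2 ^ (2 * n)) * suminf (\<lambda>i. ennreal (D i powr (2 * real n)))"
      using \<open>0 < \<rho>\<close> by (simp add: power_mult_distrib ennreal_mult)
    then show ?thesis unfolding D_def by (subst (asm) ennreal_mult_le_mult_iff) auto
  qed
  have "ennreal (\<rho> ^ (2 * n)) \<le> Cn.hausdorff_pre n (2 * real n) 1 B"
    unfolding Cn.hausdorff_pre_def using lower by (intro INF_greatest) auto
  also have "\<dots> \<le> Cn.hausdorff n (2 * real n) B" unfolding Cn.hausdorff_def by (intro SUP_upper) auto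
  finally show ?thesis by (simp only: \<rho>_def)
qed

section \<open>The Remez inequality\<close>

lemma line_poly_poly_eval:
  assumes "total_degree p = k"
  shows "line_poly k (\<lambda>z. poly_eval p (\<lambda>i. x i + c * z i))"
  unfolding line_poly_def
proof (intro allI)
  fix y v :: "nat \<Rightarrow> complex"
  define q where "q = (\<Sum>m\<in>Poly_Mapping.keys p. smult (Poly_Mapping.lookup p m)
    (\<Prod>i\<in>Poly_Mapping.keys m. [:x i + c * y i, c * v i:] ^ Poly_Mapping.lookup m i))"
  have "Polynomial.degree q \<le> k" unfolding q_def
  proof (rule degree_sum_le)
    fix m assume m: "m \<in> Poly_Mapping.keys p"
    have "Polynomial.degree (\<Prod>i\<in>Poly_Mapping.keys m. [:x i + c * y i, c * v i:] ^ Poly_Mapping.lookup m i)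
      \<le> (\<Sum>i\<in>Poly_Mapping.keys m. Polynomial.degree ([:x i + c * y i, c * v i:] ^ Poly_Mapping.lookup m i))"
      by (rule degree_prod_sum_le[unfolded o_def]) simp
    also have "\<dots> \<le> monom_degree m" unfolding monom_degree_def
    proof (rule sum_mono)
      fix i
      have "Polynomial.degree [:x i + c * y i, c * v i:] \<le> 1" by simp
      then have "Polynomial.degree [:x i + c * y i, c * v i:] * Poly_Mapping.lookup m i \<le> 1 * Poly_Mapping.lookup m i"
        by (rule mult_right_mono) simp
      then show "Polynomial.degree ([:x i + c * y i, c * v i:] ^ Poly_Mapping.lookup m i) \<le> Poly_Mapping.lookup m i"
        using degree_power_le[of "[:x i + c * y i, c * v i:]" "Poly_Mapping.lookup m i"] by linarith
    qed
    also have "\<dots> \<le> k" using m unfolding assms[symmetric] total_degree_def by (intro Max_ge) auto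
    finally show "Polynomial.degree (smult (Poly_Mapping.lookup p m)
        (\<Prod>i\<in>Poly_Mapping.keys m. [:x i + c * y i, c * v i:] ^ Poly_Mapping.lookup m i)) \<le> k"
      using degree_smult_le order_trans by blast
  qed simp
  moreover have "\<forall>w. poly_eval p (\<lambda>i. x i + c * (y i + w * v i)) = poly q w"
    by (simp add: poly_eval_def q_def poly_sum poly_prod algebra_simps)
  ultimately show "\<exists>q. Polynomial.degree q \<le> k \<and> (\<forall>w. poly_eval p (\<lambda>i. x i + c * (y i + w * v i)) = poly q w)"
    by blast
qed

lemma poly_eval_bdd_above:
  assumes "poly_in n p"
  shows "bdd_above ((\<lambda>z. cmod (poly_eval p z)) ` polydisc n x r)"
proof (rule bdd_aboveI2)
  fix z assume z: "z \<in> polydisc n x r"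
  have "cmod (poly_eval p z) \<le> (\<Sum>m\<in>Poly_Mapping.keys p. cmod (Poly_Mapping.lookup p m *
      (\<Prod>i\<in>Poly_Mapping.keys m. z i ^ Poly_Mapping.lookup m i)))"
    unfolding poly_eval_def by (rule norm_sum)
  also have "\<dots> \<le> (\<Sum>m\<in>Poly_Mapping.keys p. cmod (Poly_Mapping.lookup p m) *
      (\<Prod>i\<in>Poly_Mapping.keys m. (cmod (x i) + r) ^ Poly_Mapping.lookup m i))"
  proof (rule sum_mono)
    fix m assume m: "m \<in> Poly_Mapping.keys p"
    have "cmod (z i) \<le> cmod (x i) + r" if "i \<in> Poly_Mapping.keys m" for i
    proof -
      have "i < n" using assms m that by (auto simp: poly_in_def)
      then show ?thesis using polydiscD[OF z] norm_triangle_ineq2[of "z i" "x i"] by fastforce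
    qed
    then show "cmod (Poly_Mapping.lookup p m * (\<Prod>i\<in>Poly_Mapping.keys m. z i ^ Poly_Mapping.lookup m i))
      \<le> cmod (Poly_Mapping.lookup p m) * (\<Prod>i\<in>Poly_Mapping.keys m. (cmod (x i) + r) ^ Poly_Mapping.lookup m i)"
      by (auto simp: norm_mult norm_power prod_norm[symmetric] intro!: mult_left_mono prod_mono power_mono)
  qed
  finally show "cmod (poly_eval p z) \<le> (\<Sum>m\<in>Poly_Mapping.keys p. cmod (Poly_Mapping.lookup p m) *
      (\<Prod>i\<in>Poly_Mapping.keys m. (cmod (x i) + r) ^ Poly_Mapping.lookup m i))" .
qed

lemma hausdorff_sublevel_le:
  fixes n k :: nat and \<alpha> s a :: real
  assumes "1 \<le> n" and s: "s = 2 * real n - 2 + \<alpha>" and "0 < \<alpha>" "0 < a"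
  obtains c A :: real where "0 < c" "0 < A"
    "\<And>X p x R y r. \<lbrakk>X \<in> Cn.ahlfors n s a; poly_in n p; total_degree p = k; 0 < R;
        y \<in> polydisc n x R; poly_eval p y \<noteq> 0; 0 < r; r \<le> 1\<rbrakk> \<Longrightarrow>
      Cn.hausdorff n s {z \<in> X \<inter> polydisc n x R. cmod (poly_eval p z) \<le> c * r ^ k * cmod (poly_eval p y)}
        \<le> ennreal (A * r powr \<alpha> * R powr s)"
proof -
  have "0 < s" using assms by simp
  obtain c C :: real where c: "0 < c" and C: "0 < C"
    and cover: "\<And>f r y0. \<lbrakk>line_poly k f; \<And>z. bdd_above ((\<lambda>y. cmod (f y)) ` polydisc n z r);
        y0 \<in> polydisc n (\<lambda>_. 0) 1; f y0 \<noteq> 0; 0 < r; r \<le> 1\<rbrakk> \<Longrightarrow>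
      \<exists>T. finite T \<and> real (card T) \<le> C / r ^ (2 * (n - 1)) \<and>
        (\<forall>z\<in>polydisc n (\<lambda>_. 0) 1. cmod (f z) \<le> c * r ^ k * cmod (f y0) \<longrightarrow>
           (\<exists>t\<in>T. z \<in> polydisc n t (3 * r)))"
    using sublevel_covering[OF \<open>1 \<le> n\<close>, of k] by blast
  define K where "K = ((16 * real n + 2)\<^sup>2) ^ n"
  have "0 < K" by (simp add: K_def add_nonneg_pos)
  define A where "A = C * (K * (a * 3 powr s))"
  have "0 < A" using C \<open>0 < K\<close> \<open>0 < a\<close> by (simp add: A_def)
  have "Cn.hausdorff n s {z \<in> X \<inter> polydisc n x R. cmod (poly_eval p z) \<le> c * r ^ k * cmod (poly_eval p y)}
        \<le> ennreal (A * r powr \<alpha> * R powr s)"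
    if X: "X \<in> Cn.ahlfors n s a" and p: "poly_in n p" "total_degree p = k" and "0 < R"
      and y: "y \<in> polydisc n x R" "poly_eval p y \<noteq> 0" and r: "0 < r" "r \<le> 1" for X p x R y r
  proof -
    define f where "f = (\<lambda>z. poly_eval p (\<lambda>i. x i + of_real R * z i))"
    have scale: "(\<lambda>i. x i + of_real R * ((z i - x i) / of_real R)) = z" for z
      using \<open>0 < R\<close> by auto
    have unscale: "(\<lambda>i. (z i - x i) / of_real R) \<in> polydisc n (\<lambda>_. 0) 1" if "z \<in> polydisc n x R" for z
      using that \<open>0 < R\<close> by (auto simp: polydisc_def norm_divide)
    have rescale: "(\<lambda>i. x i + of_real R * z i) \<in> polydisc n (\<lambda>i. x i + of_real R * t i) (R * \<rho>)"
      if "z \<in> polydisc n t \<rho>" for z t \<rho>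
      using that \<open>0 < R\<close> by (auto simp: polydisc_def norm_mult simp flip: right_diff_distrib)
    have f: "line_poly k f" unfolding f_def by (rule line_poly_poly_eval[OF p(2)])
    have bdd: "bdd_above ((\<lambda>z. cmod (f z)) ` polydisc n t r)" for t
      by (rule bdd_above_mono[OF poly_eval_bdd_above[OF p(1), of "\<lambda>i. x i + of_real R * t i" "R * r"]])
        (use rescale in \<open>auto simp: f_def\<close>)
    have f_unscale: "f (\<lambda>i. (z i - x i) / of_real R) = poly_eval p z" for z by (simp only: f_def scale)
    obtain T where T: "finite T" "real (card T) \<le> C / r ^ (2 * (n - 1))"
      and T_cover: "\<And>z. z \<in> polydisc n (\<lambda>_. 0) 1 \<Longrightarrow> cmod (f z) \<le> c * r ^ k * cmod (poly_eval p y) \<Longrightarrow>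
           \<exists>t\<in>T. z \<in> polydisc n t (3 * r)"
      using cover[OF f bdd unscale[OF y(1)] _ r] y(2) unfolding f_unscale by blast
    define E where "E = {z \<in> X \<inter> polydisc n x R. cmod (poly_eval p z) \<le> c * r ^ k * cmod (poly_eval p y)}"
    define W where "W = (\<lambda>t. polydisc n (\<lambda>i. x i + of_real R * t i) (R * (3 * r)))"
    have "Cn.hausdorff n s E \<le> ennreal (C / r ^ (2 * (n - 1)) * (K * (a * (R * (3 * r)) powr s)))"
    proof (rule Cn.hausdorff_finite_cover[OF \<open>0 < s\<close> T(1) _ _ T(2) _ cspace_nonempty, where W = W])
      show "E \<subseteq> (\<Union>t\<in>T. W t)"
      proof
        fix z assume z: "z \<in> E"
        then obtain t where "t \<in> T" "(\<lambda>i. (z i - x i) / of_real R) \<in> polydisc n t (3 * r)"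
          using T_cover[of "\<lambda>i. (z i - x i) / of_real R"] unscale[of z] unfolding E_def f_unscale by blast
        then show "z \<in> (\<Union>t\<in>T. W t)" using rescale[of "\<lambda>i. (z i - x i) / of_real R" t "3 * r"]
          unfolding scale W_def by blast
      qed
      show "Cn.hausdorff n s (E \<inter> W t) \<le> ennreal (K * (a * (R * (3 * r)) powr s))" for t
      proof -
        have "Cn.hausdorff n s (E \<inter> W t) \<le> Cn.hausdorff n s (X \<inter> W t)"
          by (rule Cn.hausdorff_mono) (auto simp: E_def)
        also have "\<dots> \<le> ennreal (K * (a * (R * (3 * r)) powr s))"
          unfolding W_def K_def using X \<open>0 < s\<close> \<open>0 < a\<close> \<open>0 < R\<close> r \<open>1 \<le> n\<close>
          by (intro hausdorff_ahlfors_polydisc) auto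
        finally show ?thesis .
      qed
    qed (use \<open>0 < K\<close> \<open>0 < a\<close> in auto)
    moreover have "C / r ^ (2 * (n - 1)) * (K * (a * (R * (3 * r)) powr s)) = A * r powr \<alpha> * R powr s"
    proof -
      have "r powr s = r powr real (2 * (n - 1)) * r powr \<alpha>"
        using \<open>1 \<le> n\<close> by (simp add: s of_nat_diff flip: powr_add)
      also have "r powr real (2 * (n - 1)) = r ^ (2 * (n - 1))" using r by (intro powr_realpow)
      finally have "r powr s = r ^ (2 * (n - 1)) * r powr \<alpha>" .
      then show ?thesis using r \<open>0 < R\<close> by (simp add: A_def powr_mult field_simps)
    qed
    ultimately show ?thesis unfolding E_def by simp
  qed
  show ?thesis by (rule that[of c A]; fact)
qed

lemma poly_eval_le_of_hausdorff:
  fixes n k :: nat and \<alpha> s a :: real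
  assumes "1 \<le> n" and s: "s = 2 * real n - 2 + \<alpha>" and "0 < \<alpha>" "0 < a"
  obtains c A :: real where "0 < c" "0 < A"
    "\<And>X p x R y \<omega> \<epsilon>. \<lbrakk>X \<in> Cn.ahlfors n s a; poly_in n p; total_degree p = k; 0 < R;
        y \<in> polydisc n x R; \<omega> \<subseteq> X \<inter> polydisc n x R; 0 < Cn.hausdorff n s \<omega>;
        \<And>z. z \<in> \<omega> \<Longrightarrow> cmod (poly_eval p z) \<le> \<epsilon>\<rbrakk> \<Longrightarrow>
      0 < enn2real (Cn.hausdorff n s \<omega>) \<and> enn2real (Cn.hausdorff n s \<omega>) \<le> A * R powr s \<and>
      cmod (poly_eval p y) \<le> c * (A * R powr s / enn2real (Cn.hausdorff n s \<omega>)) powr (k / \<alpha>) * \<epsilon>"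
proof -
  have "0 < s" using assms by simp
  obtain c A :: real where c: "0 < c" and A: "0 < A"
    and sub: "\<And>X p x R y r. \<lbrakk>X \<in> Cn.ahlfors n s a; poly_in n p; total_degree p = k; 0 < R;
        y \<in> polydisc n x R; poly_eval p y \<noteq> 0; 0 < r; r \<le> 1\<rbrakk> \<Longrightarrow>
      Cn.hausdorff n s {z \<in> X \<inter> polydisc n x R. cmod (poly_eval p z) \<le> c * r ^ k * cmod (poly_eval p y)}
        \<le> ennreal (A * r powr \<alpha> * R powr s)"
    using hausdorff_sublevel_le[OF assms(1-4), of k] by blast
  define K where "K = ((16 * real n + 2)\<^sup>2) ^ n"
  define A' where "A' = max A (K * a)"
  have "0 < A'" using A by (simp add: A'_def)
  have "0 < 2 ^ k / c" using c by simp
  have "0 < enn2real (Cn.hausdorff n s \<omega>) \<and> enn2real (Cn.hausdorff n s \<omega>) \<le> A' * R powr s \<and>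
      cmod (poly_eval p y) \<le> 2 ^ k / c * (A' * R powr s / enn2real (Cn.hausdorff n s \<omega>)) powr (k / \<alpha>) * \<epsilon>"
    if X: "X \<in> Cn.ahlfors n s a" and p: "poly_in n p" "total_degree p = k" and R: "0 < R"
      and y: "y \<in> polydisc n x R" and \<omega>: "\<omega> \<subseteq> X \<inter> polydisc n x R" "0 < Cn.hausdorff n s \<omega>"
      and \<epsilon>: "\<And>z. z \<in> \<omega> \<Longrightarrow> cmod (poly_eval p z) \<le> \<epsilon>" for X p x R y \<omega> \<epsilon>
  proof -
    define h where "h = enn2real (Cn.hausdorff n s \<omega>)"
    have "Cn.hausdorff n s \<omega> \<le> Cn.hausdorff n s (X \<inter> polydisc n x R)" using \<omega>(1) by (rule Cn.hausdorff_mono)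
    also have "\<dots> \<le> ennreal (K * (a * R powr s))"
      unfolding K_def using X \<open>0 < s\<close> \<open>0 < a\<close> R \<open>1 \<le> n\<close> by (rule hausdorff_ahlfors_polydisc)
    finally have le: "Cn.hausdorff n s \<omega> \<le> ennreal (K * (a * R powr s))" .
    then have fin: "Cn.hausdorff n s \<omega> < top" using ennreal_less_top order_le_less_trans by blast
    then have h: "Cn.hausdorff n s \<omega> = ennreal h" by (simp add: h_def)
    have "0 < h" using \<omega>(2) fin by (simp add: h_def enn2real_positive_iff)
    have "0 \<le> K" by (simp add: K_def)
    then have "h \<le> K * a * R powr s" using le \<open>0 < a\<close> by (simp add: h mult.assoc)
    also have "\<dots> \<le> A' * R powr s" by (intro mult_right_mono) (auto simp: A'_def)
    finally have h_le: "h \<le> A' * R powr s" .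
    have pos: "0 < A' * R powr s" using \<open>0 < A'\<close> R by simp
    define t where "t = (h / (A' * R powr s)) powr (1 / \<alpha>)"
    have t: "0 < t" "t \<le> 1"
      using \<open>0 < h\<close> h_le pos \<open>0 < \<alpha>\<close> by (auto simp: t_def intro!: powr_le1)
    have t_\<alpha>: "t powr \<alpha> = h / (A' * R powr s)"
      using \<open>0 < \<alpha>\<close> \<open>0 < h\<close> pos by (simp add: t_def powr_powr)
    have "\<omega> \<noteq> {}" using \<omega>(2) Cn.hausdorff_singleton[of "{}" _ n s] cspace_nonempty[of n] \<open>0 < s\<close> by auto
    then have "0 \<le> \<epsilon>" using \<epsilon> order_trans[OF norm_ge_zero] by blast
    have "cmod (poly_eval p y) \<le> 2 ^ k / c * (A' * R powr s / h) powr (k / \<alpha>) * \<epsilon>"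
    proof (cases "poly_eval p y = 0")
      case True
      then show ?thesis using c \<open>0 \<le> \<epsilon>\<close> by simp
    next
      case False
      have "c * (t / 2) ^ k * cmod (poly_eval p y) < \<epsilon>"
      proof (rule ccontr)
        assume "\<not> ?thesis"
        then have "\<omega> \<subseteq> {z \<in> X \<inter> polydisc n x R. cmod (poly_eval p z) \<le> c * (t / 2) ^ k * cmod (poly_eval p y)}"
          using \<omega>(1) \<epsilon> by force
        then have "Cn.hausdorff n s \<omega> \<le> ennreal (A * (t / 2) powr \<alpha> * R powr s)"
          using order_trans[OF Cn.hausdorff_mono sub[OF X p R y False, of "t / 2"]] t by simp
        then have "h \<le> A * (t / 2) powr \<alpha> * R powr s" using A by (simp add: h)
        also have "\<dots> \<le> A' * (t / 2) powr \<alpha> * R powr s"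
          by (intro mult_right_mono) (auto simp: A'_def)
        also have "\<dots> = h / 2 powr \<alpha>"
          using t pos R \<open>0 < A'\<close> by (simp add: powr_divide t_\<alpha>)
        also have "\<dots> < h"
        proof -
          have "2 powr 0 < 2 powr \<alpha>" using \<open>0 < \<alpha>\<close> by (intro powr_less_mono) auto
          then show ?thesis using \<open>0 < h\<close> by (simp add: divide_less_eq)
        qed
        finally show False by simp
      qed
      then have "cmod (poly_eval p y) \<le> 2 ^ k / c * (1 / t ^ k) * \<epsilon>"
        using c t by (simp add: power_divide field_simps)
      also have "1 / t ^ k = (A' * R powr s / h) powr (k / \<alpha>)"
      proof -
        have "t ^ k = t powr real k" using t by (simp add: powr_realpow)
        also have "\<dots> = (h / (A' * R powr s)) powr (k / \<alpha>)" by (simp add: t_def powr_powr)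
        finally have "t ^ k = (h / (A' * R powr s)) powr (k / \<alpha>)" .
        moreover have "A' * R powr s / h = inverse (h / (A' * R powr s))" by simp
        ultimately show ?thesis using \<open>0 < h\<close> pos by (simp only: inverse_eq_divide powr_divide powr_one_eq_one divide_nonneg_pos less_imp_le zero_le_one)
      qed
      finally show ?thesis .
    qed
    then show ?thesis using \<open>0 < h\<close> h_le by (simp only: h_def)
  qed
  show ?thesis by (rule that[of "2 ^ k / c" A']; fact)
qed

lemma euclidean_ballE:
  assumes "euclidean_ball n B"
  obtains x R where "x \<in> cspace n" "0 < R" "B \<subseteq> cspace n" "B \<subseteq> polydisc n x R" "Cn.mball n x R \<subseteq> B" "x \<in> B"
proof -
  obtain x R where xR: "x \<in> cspace n" "0 < R" "B = Cn.mball n x R \<or> B = Cn.mcball n x R"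
    using assms by (auto simp: euclidean_ball_def)
  then have "Cn.mball n x R \<subseteq> B" "B \<subseteq> Cn.mcball n x R" by (auto simp: Cn.mball_subset_mcball)
  moreover have "Cn.mcball n x R \<subseteq> polydisc n x R" by (auto simp: Cn.in_mcball mem_polydisc_cdist)
  moreover have "x \<in> Cn.mball n x R" using xR by simp
  moreover have "Cn.mcball n x R \<subseteq> cspace n" by (auto simp: Cn.in_mcball)
  ultimately show ?thesis using that xR by blast
qed

lemma poly_eval_const:
  assumes "total_degree p = 0" shows "poly_eval p x = poly_eval p y"
proof -
  obtain q where q: "Polynomial.degree q \<le> 0" "\<And>w. poly_eval p (\<lambda>i. 0 + 1 * (x i + w * (y i - x i))) = poly q w"
    using line_polyE[OF line_poly_poly_eval[OF assms, of "\<lambda>_. 0" 1], of x "\<lambda>i. y i - x i"] by metis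
  then have "poly q 0 = poly q 1" by (metis degree_eq_zeroE le_zero_eq poly_const_conv)
  then show ?thesis unfolding q(2)[symmetric] by simp
qed

theorem theorem2p1:
  fixes \<alpha> :: real
  assumes "0 < \<alpha>"
  shows "\<exists>c2::real. 0 < c2 \<and>
    (\<forall>(n::nat) (s::real) (a::real) (k::nat).
       1 \<le> n \<and> s = 2 * real n - 2 + \<alpha> \<and> s \<le> 2 * real n \<and> 0 < a \<longrightarrow>
       (\<exists>c1::real. 0 < c1 \<and>
         (\<forall>X p B \<omega>.
            X \<in> Cn.ahlfors n s a \<and>
            poly_in n p \<and> total_degree p = k \<and>
            euclidean_ball n B \<and>
            \<omega> \<subseteq> X \<inter> B \<and> \<omega> \<in> Cn.hausdorff_measurable n s \<and> 0 < Cn.hausdorff n s \<omega> \<longrightarrow>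
            (SUP z\<in>B. cmod (poly_eval p z)) \<le>
              (c1 * enn2real (Cn.hausdorff n (2 * real n) B)
                / enn2real (Cn.hausdorff n s \<omega>) powr (2 * real n / s)) powr (c2 * real k)
              * (SUP z\<in>\<omega>. cmod (poly_eval p z)))))"
proof (rule exI[of _ "1 / \<alpha>"], intro conjI allI impI)
  show "0 < 1 / \<alpha>" using assms by simp
  fix n k :: nat and s a :: real
  assume "1 \<le> n \<and> s = 2 * real n - 2 + \<alpha> \<and> s \<le> 2 * real n \<and> 0 < a"
  then have n: "1 \<le> n" and s: "s = 2 * real n - 2 + \<alpha>" "s \<le> 2 * real n" and a: "0 < a" by auto
  have "0 < s" using n s assms by simp
  obtain c A :: real where c: "0 < c" and A: "0 < A"
    and main: "\<And>X p x R y \<omega> \<epsilon>. \<lbrakk>X \<in> Cn.ahlfors n s a; poly_in n p; total_degree p = k; 0 < R;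
        y \<in> polydisc n x R; \<omega> \<subseteq> X \<inter> polydisc n x R; 0 < Cn.hausdorff n s \<omega>;
        \<And>z. z \<in> \<omega> \<Longrightarrow> cmod (poly_eval p z) \<le> \<epsilon>\<rbrakk> \<Longrightarrow>
      0 < enn2real (Cn.hausdorff n s \<omega>) \<and> enn2real (Cn.hausdorff n s \<omega>) \<le> A * R powr s \<and>
      cmod (poly_eval p y) \<le> c * (A * R powr s / enn2real (Cn.hausdorff n s \<omega>)) powr (k / \<alpha>) * \<epsilon>"
    using poly_eval_le_of_hausdorff[OF n s(1) assms a, of k] by blast
  define C where "C = A powr (2 * n / s) * (4 * real n) ^ (2 * n)"
  define c1 where "c1 = (if k = 0 then 1 else c powr (\<alpha> / k)) * C"
  have "0 < C" using A n by (simp add: C_def)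
  then have "0 < c1" using c by (simp add: c1_def)
  have remez: "(SUP z\<in>B. cmod (poly_eval p z)) \<le>
      (c1 * enn2real (Cn.hausdorff n (2 * real n) B)
         / enn2real (Cn.hausdorff n s \<omega>) powr (2 * real n / s)) powr (1 / \<alpha> * real k)
      * (SUP z\<in>\<omega>. cmod (poly_eval p z))"
    if X: "X \<in> Cn.ahlfors n s a" and p: "poly_in n p" "total_degree p = k"
      and B: "euclidean_ball n B" and \<omega>: "\<omega> \<subseteq> X \<inter> B" "0 < Cn.hausdorff n s \<omega>" for X p B \<omega>
  proof -
    obtain x R where x: "x \<in> cspace n" "x \<in> B" and R: "0 < R"
      and Bs: "B \<subseteq> cspace n" "B \<subseteq> polydisc n x R" "Cn.mball n x R \<subseteq> B"
      using euclidean_ballE[OF B] by metis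
    define \<epsilon> where "\<epsilon> = (SUP z\<in>\<omega>. cmod (poly_eval p z))"
    define h where "h = enn2real (Cn.hausdorff n s \<omega>)"
    define H where "H = enn2real (Cn.hausdorff n (2 * real n) B)"
    have \<omega>P: "\<omega> \<subseteq> X \<inter> polydisc n x R" using \<omega> Bs by blast
    have "bdd_above ((\<lambda>z. cmod (poly_eval p z)) ` \<omega>)"
      using poly_eval_bdd_above[OF p(1), of x R] by (rule bdd_above_mono) (use \<omega>P in blast)
    then have \<epsilon>: "cmod (poly_eval p z) \<le> \<epsilon>" if "z \<in> \<omega>" for z
      unfolding \<epsilon>_def using that by (intro cSUP_upper)
    have "\<omega> \<noteq> {}" using \<omega>(2) Cn.hausdorff_singleton[of "{}" x n s] x \<open>0 < s\<close> by auto
    then obtain z0 where z0: "z0 \<in> \<omega>" by blast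
    then have "0 \<le> \<epsilon>" using \<epsilon> order_trans[OF norm_ge_zero] by blast
    note main' = main[OF X p R _ \<omega>P \<omega>(2) \<epsilon>, folded h_def]
    have h: "0 < h" "h \<le> A * R powr s" using main'[of x] x Bs by auto
    have "Cn.hausdorff n (2 * real n) B < top"
      using hausdorff_full_dim_le[OF n Bs(1,2) R] ennreal_less_top order_le_less_trans by blast
    then have "ennreal H = Cn.hausdorff n (2 * real n) B" by (simp add: H_def)
    then have H: "(R / (4 * n)) ^ (2 * n) \<le> H"
      using hausdorff_full_dim_ge[OF n R x(1) Bs(3)] by (metis H_def enn2real_nonneg ennreal_le_iff)
    have "0 < (R / (4 * n)) ^ (2 * n)" using R n by simp
    with H have "0 < H" by linarith
    define Q where "Q = C * H / h powr (2 * n / s)"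
    have "0 < Q" using \<open>0 < C\<close> \<open>0 < H\<close> h by (simp add: Q_def)
    have le_Q: "A * R powr s / h \<le> Q"
    proof -
      have "1 \<le> A * R powr s / h" "1 \<le> 2 * n / s" using h s \<open>0 < s\<close> by auto
      then have "(A * R powr s / h) powr 1 \<le> (A * R powr s / h) powr (2 * n / s)" by (intro powr_mono)
      also have "\<dots> = A powr (2 * n / s) * R powr (2 * real n) / h powr (2 * n / s)"
        using A R h \<open>0 < s\<close> by (simp add: powr_divide powr_mult powr_powr)
      also have "R powr (2 * real n) = (4 * real n) ^ (2 * n) * (R / (4 * n)) ^ (2 * n)"
        using powr_double_nat[of R n] R n by (simp add: power_divide)
      also have "A powr (2 * n / s) * ((4 * real n) ^ (2 * n) * (R / (4 * n)) ^ (2 * n)) / h powr (2 * n / s)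
          = C * (R / (4 * n)) ^ (2 * n) / h powr (2 * n / s)" by (simp add: C_def)
      also have "\<dots> \<le> Q" unfolding Q_def using H \<open>0 < C\<close> by (intro divide_right_mono mult_left_mono) auto
      finally show ?thesis using h A by simp
    qed
    have bound: "cmod (poly_eval p y) \<le> (c1 * H / h powr (2 * real n / s)) powr (1 / \<alpha> * real k) * \<epsilon>" if "y \<in> B" for y
    proof (cases "k = 0")
      case True
      then have "poly_eval p y = poly_eval p z0" using p poly_eval_const by blast
      moreover have "c1 * H / h powr (2 * real n / s) \<noteq> 0" using \<open>0 < c1\<close> \<open>0 < H\<close> h by simp
      ultimately show ?thesis using True \<epsilon>[OF z0] by simp
    next
      case False
      have "cmod (poly_eval p y) \<le> c * (A * R powr s / h) powr (k / \<alpha>) * \<epsilon>"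
        using main'[of y] that Bs by blast
      also have "\<dots> \<le> c * Q powr (k / \<alpha>) * \<epsilon>"
        using le_Q c \<open>0 \<le> \<epsilon>\<close> A h assms by (intro mult_right_mono mult_left_mono powr_mono2) auto
      also have "c * Q powr (k / \<alpha>) = (c powr (\<alpha> / k) * Q) powr (k / \<alpha>)"
        using c \<open>0 < Q\<close> False assms by (simp add: powr_mult powr_powr)
      also have "c powr (\<alpha> / k) * Q = c1 * H / h powr (2 * real n / s)" using False by (simp add: c1_def Q_def)
      finally show ?thesis by simp
    qed
    show ?thesis unfolding \<epsilon>_def[symmetric] h_def[symmetric] H_def[symmetric]
      using x(2) bound by (intro cSUP_least) auto
  qed
  show "\<exists>c1::real. 0 < c1 \<and>
         (\<forall>X p B \<omega>.
            X \<in> Cn.ahlfors n s a \<and>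
            poly_in n p \<and> total_degree p = k \<and>
            euclidean_ball n B \<and>
            \<omega> \<subseteq> X \<inter> B \<and> \<omega> \<in> Cn.hausdorff_measurable n s \<and> 0 < Cn.hausdorff n s \<omega> \<longrightarrow>
            (SUP z\<in>B. cmod (poly_eval p z)) \<le>
              (c1 * enn2real (Cn.hausdorff n (2 * real n) B)
                / enn2real (Cn.hausdorff n s \<omega>) powr (2 * real n / s)) powr (1 / \<alpha> * real k)
              * (SUP z\<in>\<omega>. cmod (poly_eval p z)))"
    using \<open>0 < c1\<close> remez by blast
qed

end
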